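(* Let $n = p^kq^{\ell}$, where $p$ and $q$ are distinct primes and $k$ and $\ell$ are positive integers. Then $$I_r(\mathbb{Z}/n\mathbb{Z}) = \mathsf{D}((\mathbb{Z}/n\mathbb{Z})^\times) + (k - 1) + (\ell - 1).$$
   Context: For a finite commutative ring $R$, $I_r(R)$ (the Erdős–Burgess constant of the multiplicative semigroup of $R$) is the smallest positive integer $t$ such that every sequence of $t$ (not necessarily distinct) elements of $R$ contains a nonempty subsequence whose elements multiply to an idempotent element of $R$ (an element $x$ with $x^2=x$). For a finite abelian group $G$, the Davenport constant $\mathsf{D}(G)$ is the smallest positive integer $t$ such that every sequence of $t$ elements of $G$ contains a nonempty subsequence whose elements multiply (in the group operation) to the identity. $(\mathbb{Z}/n\mathbb{Z})^\times$ denotes the unit group of $\mathbb{Z}/n\mathbb{Z}$. *)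

theory Defs
  imports "HOL-Number_Theory.Number_Theory"
begin

text \<open>
  Sequences of length \<open>t\<close> over a carrier are functions on the index set \<open>{..<t}\<close>, and a nonempty
  subsequence is given by a nonempty set \<open>I \<subseteq> {..<t}\<close> of indices, so that repeated elements are
  counted with multiplicity. The values of such a function outside \<open>{..<t}\<close> are irrelevant.

  Applied to a ring, \<open>erdos_burgess\<close> refers to its multiplicative monoid.
\<close>

definition erdos_burgess_property :: "('a, 'b) monoid_scheme \<Rightarrow> nat \<Rightarrow> bool" where
  "erdos_burgess_property S t \<longleftrightarrow>
     (\<forall>f \<in> {..<t} \<rightarrow> carrier S. \<exists>I. I \<subseteq> {..<t} \<and> I \<noteq> {} \<and>
        finprod S f I \<otimes>\<^bsub>S\<^esub> finprod S f I = finprod S f I)"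

definition erdos_burgess :: "('a, 'b) monoid_scheme \<Rightarrow> nat" where
  "erdos_burgess S = (LEAST t. t > 0 \<and> erdos_burgess_property S t)"

definition davenport_property :: "('a, 'b) monoid_scheme \<Rightarrow> nat \<Rightarrow> bool" where
  "davenport_property G t \<longleftrightarrow>
     (\<forall>f \<in> {..<t} \<rightarrow> carrier G. \<exists>I. I \<subseteq> {..<t} \<and> I \<noteq> {} \<and> finprod G f I = \<one>\<^bsub>G\<^esub>)"

definition davenport :: "('a, 'b) monoid_scheme \<Rightarrow> nat" where
  "davenport G = (LEAST t. t > 0 \<and> davenport_property G t)"

text \<open>
  Both minima are attained for finite structures, so the uses of \<open>LEAST\<close> above are meaningful.
\<close>

lemma (in monoid) finite_idempotent_power:
  assumes "finite (carrier G)" "x \<in> carrier G"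
  shows "\<exists>n::nat. n > 0 \<and> x [^] n \<otimes> x [^] n = x [^] n"
proof -
  have "\<not> inj (\<lambda>n::nat. x [^] n)"
  proof
    assume "inj (\<lambda>n::nat. x [^] n)"
    moreover have "finite (range (\<lambda>n::nat. x [^] n))"
      by (rule finite_subset[OF _ assms(1)]) (use assms(2) in auto)
    ultimately show False
      using finite_imageD infinite_UNIV_nat by blast
  qed
  then obtain a b :: nat where ab: "a < b" "x [^] a = x [^] b"
    unfolding inj_def by (metis nat_neq_iff)
  define d where "d = b - a"
  have d: "d > 0" "b = a + d" using ab by (auto simp: d_def)
  have step: "x [^] (m + d) = x [^] m" if "m \<ge> a" for m
  proof -
    have "x [^] (m + d) = x [^] (b + (m - a))" using that d by (simp add: add.commute)
    also have "\<dots> = x [^] b \<otimes> x [^] (m - a)" using assms(2) by (simp add: nat_pow_mult)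
    also have "\<dots> = x [^] (a + (m - a))" using assms(2) ab by (simp flip: nat_pow_mult)
    finally show ?thesis using that by simp
  qed
  have steps: "x [^] (m + k * d) = x [^] m" if "m \<ge> a" for m k
  proof (induction k)
    case (Suc k)
    have "x [^] (m + Suc k * d) = x [^] ((m + k * d) + d)" by (simp add: algebra_simps)
    also have "\<dots> = x [^] m" using step[of "m + k * d"] that Suc by simp
    finally show ?case .
  qed simp
  define n where "n = Suc a * d"
  have "n \<ge> a" "n > 0" using d(1) unfolding n_def by (cases d; simp)+
  moreover have "x [^] n \<otimes> x [^] n = x [^] n"
    using steps[of n "Suc a"] \<open>n \<ge> a\<close> assms(2) by (simp add: nat_pow_mult n_def)
  ultimately show ?thesis by blast
qed

lemma (in comm_monoid) erdos_burgess_property_exists: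
  assumes fin: "finite (carrier G)"
  shows "\<exists>t>0. erdos_burgess_property G t"
proof -
  have "\<forall>x\<in>carrier G. \<exists>n::nat. n > 0 \<and> x [^] n \<otimes> x [^] n = x [^] n"
    using finite_idempotent_power fin by blast
  then obtain e :: "'a \<Rightarrow> nat" where
    e: "\<And>x. x \<in> carrier G \<Longrightarrow> e x > 0"
       "\<And>x. x \<in> carrier G \<Longrightarrow> x [^] e x \<otimes> x [^] e x = x [^] e x"
    by metis
  define t where "t = sum e (carrier G)"
  have ne: "carrier G \<noteq> {}" using one_closed by blast
  have "t > 0" unfolding t_def using fin ne e(1) by (simp add: sum_pos)
  moreover have "erdos_burgess_property G t"
    unfolding erdos_burgess_property_def
  proof
    fix f assume f: "f \<in> {..<t} \<rightarrow> carrier G"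
    have "\<exists>x\<in>carrier G. e x \<le> card {i \<in> {..<t}. f i = x}"
    proof (rule ccontr)
      assume "\<not> ?thesis"
      then have less: "card {i \<in> {..<t}. f i = x} < e x" if "x \<in> carrier G" for x
        using that by (meson not_le)
      have "t = (\<Sum>i<t. 1)" by simp
      also have "\<dots> = (\<Sum>x\<in>carrier G. \<Sum>i\<in>{i \<in> {..<t}. f i = x}. 1)"
        using f fin by (intro sum.group[symmetric]) auto
      also have "\<dots> = (\<Sum>x\<in>carrier G. card {i \<in> {..<t}. f i = x})" by simp
      also have "\<dots> < t" unfolding t_def[symmetric]
        using sum_strict_mono[OF fin ne less] by (simp add: t_def)
      finally show False by simp
    qed
    then obtain x I where x: "x \<in> carrier G" and I: "I \<subseteq> {i \<in> {..<t}. f i = x}" "card I = e x"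
      by (meson obtain_subset_with_card_n)
    have "finprod G f I = finprod G (\<lambda>_. x) I"
      using I x by (intro finprod_cong') auto
    also have "\<dots> = x [^] e x" using x I(2) by (simp add: finprod_const)
    finally have "finprod G f I \<otimes> finprod G f I = finprod G f I" using e(2)[OF x] by simp
    moreover have "I \<noteq> {}" using I(2) e(1)[OF x] by auto
    ultimately show "\<exists>I. I \<subseteq> {..<t} \<and> I \<noteq> {} \<and> finprod G f I \<otimes> finprod G f I = finprod G f I"
      using I(1) by blast
  qed
  ultimately show ?thesis by blast
qed

lemma (in comm_group) davenport_property_exists:
  assumes "finite (carrier G)"
  shows "\<exists>t>0. davenport_property G t"
proof -
  obtain t where t: "t > 0" "erdos_burgess_property G t"
    using erdos_burgess_property_exists[OF assms] by blast
  have "davenport_property G t"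
    unfolding davenport_property_def
  proof
    fix f assume f: "f \<in> {..<t} \<rightarrow> carrier G"
    then obtain I where I: "I \<subseteq> {..<t}" "I \<noteq> {}" "finprod G f I \<otimes> finprod G f I = finprod G f I"
      using t(2) unfolding erdos_burgess_property_def by blast
    have "finprod G f I \<in> carrier G" using f I(1) by (intro finprod_closed) auto
    then have "finprod G f I = \<one>" using I(3) l_cancel_one by blast
    then show "\<exists>I. I \<subseteq> {..<t} \<and> I \<noteq> {} \<and> finprod G f I = \<one>" using I by blast
  qed
  then show ?thesis using t(1) by blast
qed

end

theory Submission
  imports Defs
begin

text \<open>
  A sequence with at least \<open>k\<close> multiples of \<open>p\<close> and at least \<open>l\<close> multiples of \<open>q\<close> has product 0, so
  let fewer than \<open>l\<close> elements be multiples of \<open>q\<close>, and drop these. The multiples of \<open>p\<close> that remain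
  (the marked elements) count only through their residues in the unit group \<open>G\<close> modulo \<open>q ^ l\<close>: one
  needs a product-one subsequence of units, or a subsequence containing at least \<open>k\<close> marked elements
  whose product is one in \<open>G\<close>.

  Let \<open>K\<close> be the stabilizer in \<open>G\<close> of the set of subproducts of the units. The units lying over \<open>K\<close>,
  together with a lifted product-free sequence of \<open>G Mod K\<close> of maximal length, are product-free, and
  so is this sequence with one more element if the other units have a product-one
  subsequence modulo \<open>K\<close>. This bounds the number of units over \<open>K\<close> by the Davenport constant and
  reduces the problem to \<open>G Mod K\<close>, where the set of subproducts is aperiodic.

  There, inverses of marked elements are appended to the units as long as the set of
  subproducts grows; if it stops growing, the remaining marked elements stabilize it, which is as good
  as having reached the whole group. In a cyclic group of order \<open>N\<close> any \<open>N - 1\<close> growing steps reach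
  the whole group. The other case, which occurs only for \<open>q = 2\<close>, is a 2-group of order \<open>2 * N\<close>
  generated by an involution and an element of order \<open>N\<close>. There \<open>N + 1\<close> growing steps
  suffice, which is one more than wanted. The lost step is compensated by the extra element above,
  unless the units are product-free modulo \<open>K\<close>; in that case the group algebra over the field with
  two elements is used, in which products of \<open>N + 1\<close> differences vanish.
\<close>

section \<open>Growth of sets of subproducts\<close>

text \<open>The empty subsequence is included. Lists are used so that elements can be added one at a
  time; in a commutative group the order of the entries is immaterial.\<close>

primrec subprods :: "('a, 'b) monoid_scheme \<Rightarrow> 'a list \<Rightarrow> 'a set" where
  "subprods G [] = {\<one>\<^bsub>G\<^esub>}"
| "subprods G (x # xs) = subprods G xs \<union> (\<lambda>y. x \<otimes>\<^bsub>G\<^esub> y) ` subprods G xs"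

text \<open>No nonempty subsequence has product one: such a subsequence with first entry
  \<open>x\<close> amounts to \<open>inv x\<close> being a subproduct of the tail.\<close>

primrec product_free :: "('a, 'b) monoid_scheme \<Rightarrow> 'a list \<Rightarrow> bool" where
  "product_free G [] \<longleftrightarrow> True"
| "product_free G (x # xs) \<longleftrightarrow> product_free G xs \<and> inv\<^bsub>G\<^esub> x \<notin> subprods G xs"

text \<open>Read from the right, every entry enlarges the set of subproducts: a translate of a
  finite set that differs from the set is not contained in it.\<close>

primrec growing :: "('a, 'b) monoid_scheme \<Rightarrow> 'a list \<Rightarrow> bool" where
  "growing G [] \<longleftrightarrow> True"
| "growing G (x # xs) \<longleftrightarrow> growing G xs \<and> (\<lambda>y. x \<otimes>\<^bsub>G\<^esub> y) ` subprods G xs \<noteq> subprods G xs"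

definition aperiodic :: "('a, 'b) monoid_scheme \<Rightarrow> 'a set \<Rightarrow> bool" where
  "aperiodic G A \<longleftrightarrow> (\<forall>v \<in> carrier G. (\<lambda>y. v \<otimes>\<^bsub>G\<^esub> y) ` A = A \<longrightarrow> v = \<one>\<^bsub>G\<^esub>)"

definition in_cyclic :: "('a, 'b) monoid_scheme \<Rightarrow> 'a set \<Rightarrow> bool" where
  "in_cyclic G A \<longleftrightarrow> (\<exists>g \<in> carrier G. A \<subseteq> generate G {g})"

context comm_group
begin

section \<open>Sets of subproducts and their stabilizers\<close>

lemma finite_subprods [simp]: "finite (subprods G xs)"
  by (induction xs) auto

lemma one_in_subprods [simp]: "\<one> \<in> subprods G xs"
  by (induction xs) auto

lemma subprods_carrier: "set xs \<subseteq> carrier G \<Longrightarrow> subprods G xs \<subseteq> carrier G"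
  by (induction xs) auto

lemma subprods_mem_generate: "set xs \<subseteq> generate G S \<Longrightarrow> subprods G xs \<subseteq> generate G S"
  by (induction xs) (auto intro: generate.one generate.eng)

lemma mem_subprods: "set xs \<subseteq> carrier G \<Longrightarrow> x \<in> set xs \<Longrightarrow> x \<in> subprods G xs"
proof (induction xs)
  case (Cons a xs)
  then show ?case by (cases "x = a") (auto intro!: image_eqI[where x = \<one>])
qed simp

lemma card_translate: "x \<in> carrier G \<Longrightarrow> A \<subseteq> carrier G \<Longrightarrow> card ((\<lambda>y. x \<otimes> y) ` A) = card A"
  by (intro card_image inj_on_subset[OF inj_on_cmult])

lemma translate_translate:
  "x \<in> carrier G \<Longrightarrow> y \<in> carrier G \<Longrightarrow> A \<subseteq> carrier G \<Longrightarrow>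
    (\<lambda>z. x \<otimes> z) ` (\<lambda>z. y \<otimes> z) ` A = (\<lambda>z. (x \<otimes> y) \<otimes> z) ` A"
  by (auto simp: image_image m_assoc subset_iff intro!: image_cong)

lemma translate_one: "A \<subseteq> carrier G \<Longrightarrow> (\<lambda>z. \<one> \<otimes> z) ` A = A"
  by (force simp: subset_iff)

lemma translate_subset_eq:
  assumes "finite A" "A \<subseteq> carrier G" "x \<in> carrier G" "(\<lambda>y. x \<otimes> y) ` A \<subseteq> A"
  shows "(\<lambda>y. x \<otimes> y) ` A = A"
  using assms by (intro card_subset_eq) (auto simp: card_translate)

lemma translate_inv:
  assumes "A \<subseteq> carrier G" "x \<in> carrier G" "(\<lambda>y. x \<otimes> y) ` A = A"
  shows "(\<lambda>y. inv x \<otimes> y) ` A = A"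
  using translate_translate[of "inv x" x A] assms by (simp add: translate_one)

lemma subprods_swap:
  assumes "set xs \<subseteq> carrier G" "x \<in> carrier G" "y \<in> carrier G"
  shows "subprods G (x # y # xs) = subprods G (y # x # xs)"
proof -
  have "subprods G xs \<subseteq> carrier G" using subprods_carrier assms by blast
  then show ?thesis using assms
    by (auto simp: image_Un translate_translate m_comm)
qed

lemma subprods_remove1:
  "set xs \<subseteq> carrier G \<Longrightarrow> s \<in> set xs \<Longrightarrow> subprods G xs = subprods G (s # remove1 s xs)"
proof (induction xs)
  case (Cons a xs)
  show ?case
  proof (cases "s = a")
    case False
    then have "s \<in> set xs" using Cons.prems by auto
    then have "subprods G (a # xs) = subprods G (a # s # remove1 s xs)"
      using Cons by simp
    also have "\<dots> = subprods G (s # a # remove1 s xs)"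
      using Cons.prems \<open>s \<in> set xs\<close> by (intro subprods_swap) (auto dest: notin_set_remove1 simp: subset_iff)
    finally show ?thesis using False by simp
  qed simp
qed simp

text \<open>Translations commute, so what fixes the set of the tail also fixes its translate by
  \<open>x\<close>: stabilizers only grow when elements are added.\<close>

lemma stable_subprods:
  assumes "set xs \<subseteq> carrier G" "x \<in> carrier G" "v \<in> carrier G"
    "(\<lambda>y. v \<otimes> y) ` subprods G xs = subprods G xs"
  shows "(\<lambda>y. v \<otimes> y) ` subprods G (x # xs) = subprods G (x # xs)"
proof -
  have *: "subprods G xs \<subseteq> carrier G" using subprods_carrier assms by blast
  have "(\<lambda>y. v \<otimes> y) ` (\<lambda>y. x \<otimes> y) ` subprods G xs = (\<lambda>y. x \<otimes> y) ` (\<lambda>y. v \<otimes> y) ` subprods G xs"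
    using * assms(1-3) by (simp only: translate_translate m_comm[of v x])
  then show ?thesis using assms(4) by (simp add: image_Un)
qed

lemma aperiodic_tail:
  assumes "set (x # xs) \<subseteq> carrier G" "aperiodic G (subprods G (x # xs))"
  shows "aperiodic G (subprods G xs)"
  using assms stable_subprods[of xs x] unfolding aperiodic_def by auto

text \<open>Every tail is aperiodic too, since stabilizers only grow. An entry that fails to enlarge
  the set of its tail is therefore \<one>.\<close>

lemma growing_if_aperiodic:
  "set xs \<subseteq> carrier G \<Longrightarrow> \<one> \<notin> set xs \<Longrightarrow> aperiodic G (subprods G xs) \<Longrightarrow> growing G xs"
proof (induction xs)
  case (Cons x xs)
  then have "aperiodic G (subprods G xs)" using aperiodic_tail by blast
  then show ?case using Cons unfolding aperiodic_def by auto
qed simp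

lemma card_growing:
  assumes "set xs \<subseteq> carrier G" "growing G xs"
  shows "card (subprods G xs) \<ge> length xs + 1"
  using assms
proof (induction xs)
  case (Cons x xs)
  then have *: "subprods G xs \<subseteq> carrier G" using subprods_carrier by simp
  have "\<not> (\<lambda>y. x \<otimes> y) ` subprods G xs \<subseteq> subprods G xs"
    using translate_subset_eq[of "subprods G xs" x] Cons.prems * by auto
  then have "card (subprods G xs) < card (subprods G (x # xs))"
    by (intro psubset_card_mono) auto
  then show ?case using Cons by simp
qed simp

text \<open>The subproducts with and without \<open>x\<close> lie in different cosets of the
  subgroup generated by \<open>S\<close>.\<close>

lemma card_subprods_Cons_outside:
  assumes "set xs \<subseteq> generate G S" "S \<subseteq> carrier G" "x \<in> carrier G" "x \<notin> generate G S"
  shows "card (subprods G (x # xs)) = 2 * card (subprods G xs)"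
proof -
  have sub: "subprods G xs \<subseteq> generate G S" using subprods_mem_generate assms by blast
  have car: "generate G S \<subseteq> carrier G" using generate_incl assms by blast
  have "subprods G xs \<inter> (\<lambda>y. x \<otimes> y) ` subprods G xs = {}"
  proof (rule ccontr)
    assume "\<not> ?thesis"
    then obtain a where a: "a \<in> generate G S" "x \<otimes> a \<in> generate G S" using sub by auto
    then have "x \<otimes> a \<otimes> inv a \<in> generate G S"
      using assms(2) by (meson generate_is_subgroup subgroup.m_closed subgroup.m_inv_closed)
    moreover have "x \<otimes> a \<otimes> inv a = x" using a(1) car assms(3) by (simp add: m_assoc subset_iff)
    ultimately show False using assms(4) by simp
  qed
  then show ?thesis using sub car assms(3) by (simp add: card_Un_disjoint card_translate)
qed


section \<open>Translations that exchange a single point\<close>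

text \<open>Exactly one element \<open>c\<close> of \<open>A\<close> lies outside \<open>B\<close>,
  and \<open>s\<close> maps \<open>B\<close> into \<open>A\<close>. So only
  \<open>s \<otimes> c\<close> can fall outside \<open>A\<close>, and it does because
  \<open>A\<close> is aperiodic. The translate has the same size as \<open>A\<close>, hence it
  misses exactly one point of \<open>A\<close> in return.\<close>

lemma translate_exchange:
  assumes A: "finite A" "A \<subseteq> carrier G" "aperiodic G A"
    and s: "s \<in> carrier G" "s \<noteq> \<one>"
    and B: "A = B \<union> (\<lambda>y. s \<otimes> y) ` B" "card A \<le> card B + 1"
  obtains a b where "a \<in> A" "b \<in> carrier G" "b \<notin> A" "(\<lambda>y. s \<otimes> y) ` A = insert b (A - {a})"
proof -
  let ?sA = "(\<lambda>y. s \<otimes> y) ` A"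
  have "?sA \<noteq> A" using A(3) s unfolding aperiodic_def by blast
  then have nsub: "\<not> ?sA \<subseteq> A" using translate_subset_eq A s by blast
  have BA: "B \<subseteq> A" using B(1) by blast
  have "B \<noteq> A" using nsub B(1) by blast
  then have "card (A - B) = 1"
    using BA A(1) B(2) psubset_card_mono[OF A(1), of B] by (simp add: card_Diff_subset finite_subset psubset_eq)
  then obtain c where c: "A - B = {c}" by (auto simp: card_1_singleton_iff)
  define b where "b = s \<otimes> c"
  have sA: "?sA \<subseteq> insert b A" using B(1) c BA unfolding b_def by blast
  then have b: "b \<notin> A" "b \<in> ?sA" using nsub by blast+
  have card: "card ?sA = card A" using card_translate A s by blast
  have "?sA - A = {b}" using sA b by blast
  moreover have "card (A - ?sA) = card (?sA - A)"
    using A(1) card by (simp add: card_Diff_subset_Int Int_commute)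
  ultimately have "card (A - ?sA) = 1" by simp
  then obtain a where a: "A - ?sA = {a}" by (auto simp: card_1_singleton_iff)
  have "?sA = insert b (A - {a})" using a sA b by blast
  moreover have "b \<in> carrier G" using b(2) A(2) s(1) by auto
  moreover have "a \<in> A" using a by blast
  ultimately show ?thesis using that b(1) by blast
qed

lemma translate_exchange_iff:
  assumes "A \<subseteq> carrier G" "s \<in> carrier G" "(\<lambda>y. s \<otimes> y) ` A = insert b (A - {a})" "y \<in> carrier G"
  shows "y \<in> A \<longleftrightarrow> s \<otimes> y = b \<or> (s \<otimes> y \<in> A \<and> s \<otimes> y \<noteq> a)"
proof -
  have "y \<in> A \<longleftrightarrow> s \<otimes> y \<in> (\<lambda>y. s \<otimes> y) ` A"
    using inj_on_image_mem_iff[OF inj_on_cmult[OF assms(2)] assms(4,1)] by simp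
  then show ?thesis using assms(3) by auto
qed

text \<open>
  The proof compares the points exchanged by translating by \<open>s\<close> and \<open>t\<close> in the two possible orders.
\<close>

lemma translate_exchange_commute:
  assumes A: "A \<subseteq> carrier G" and s: "s \<in> carrier G" "s \<noteq> \<one>" and t: "t \<in> carrier G" "t \<noteq> \<one>"
    and st: "s \<noteq> t" "s \<otimes> t \<noteq> \<one>"
    and a: "a \<in> A" "b \<in> carrier G" "b \<notin> A" "(\<lambda>y. s \<otimes> y) ` A = insert b (A - {a})"
    and c: "c \<in> A" "d \<in> carrier G" "d \<notin> A" "(\<lambda>y. t \<otimes> y) ` A = insert d (A - {c})"
  shows "(a = c \<and> b = s \<otimes> a \<and> d = t \<otimes> c) \<or> (b = d \<and> a = s \<otimes> b \<and> c = t \<otimes> d)"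
proof -
  let ?i = "of_bool :: bool \<Rightarrow> int"
  have car: "a \<in> carrier G" "c \<in> carrier G" using A a c by auto
  have s_eq: "?i (y \<in> A) = ?i (s \<otimes> y \<in> A) + ?i (s \<otimes> y = b) - ?i (s \<otimes> y = a)" if "y \<in> carrier G" for y
    using translate_exchange_iff[OF A s(1) a(4) that] a by auto
  have t_eq: "?i (y \<in> A) = ?i (t \<otimes> y \<in> A) + ?i (t \<otimes> y = d) - ?i (t \<otimes> y = c)" if "y \<in> carrier G" for y
    using translate_exchange_iff[OF A t(1) c(4) that] c by auto
  \<comment> \<open>Both sides are the change of the indicator function of \<open>A\<close> between
    \<open>y\<close> and \<open>h = s \<otimes> t \<otimes> y\<close>, computed by passing through
    \<open>s \<otimes> y\<close> and through \<open>t \<otimes> y\<close>.\<close>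
  have E: "?i (h = d) - ?i (h = c) + ?i (h = t \<otimes> b) - ?i (h = t \<otimes> a)
         = ?i (h = b) - ?i (h = a) + ?i (h = s \<otimes> d) - ?i (h = s \<otimes> c)" if h: "h \<in> carrier G" for h
  proof -
    define y where "y = inv s \<otimes> (inv t \<otimes> h)"
    have y: "y \<in> carrier G" using h s t by (simp add: y_def)
    have sy: "s \<otimes> y = inv t \<otimes> h" using h s t by (simp add: y_def flip: m_assoc)
    have "t \<otimes> y = inv s \<otimes> (t \<otimes> (inv t \<otimes> h))" using h s t by (simp add: y_def m_lcomm)
    also have "t \<otimes> (inv t \<otimes> h) = h" using h t by (simp flip: m_assoc)
    finally have ty: "t \<otimes> y = inv s \<otimes> h" .
    have h1: "t \<otimes> (s \<otimes> y) = h" "s \<otimes> (t \<otimes> y) = h" using sy ty h s t by (simp_all flip: m_assoc)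
    have conv1: "s \<otimes> y = z \<longleftrightarrow> h = t \<otimes> z" if "z \<in> carrier G" for z
      using that h1(1) y s(1) t(1) Units_l_cancel[of t "s \<otimes> y" z] by auto
    have conv2: "t \<otimes> y = z \<longleftrightarrow> h = s \<otimes> z" if "z \<in> carrier G" for z
      using that h1(2) y s(1) t(1) Units_l_cancel[of s "t \<otimes> y" z] by auto
    show ?thesis
      using s_eq[OF y] t_eq[of "s \<otimes> y"] t_eq[OF y] s_eq[of "t \<otimes> y"] y s t
      by (simp add: h1 conv1 conv2 car a(2) c(2))
  qed
  have nofix: "s \<otimes> z \<noteq> z" "t \<otimes> z \<noteq> z" if "z \<in> carrier G" for z
    using that s t by simp_all
  have ne: "a \<noteq> b" "a \<noteq> d" "c \<noteq> b" "c \<noteq> d" using a c by auto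
  note nofix' = nofix(1)[OF car(1)] nofix(2)[OF car(1)] nofix(1)[OF car(2)] nofix(2)[OF car(2)]
    nofix(1)[OF a(2)] nofix(2)[OF a(2)] nofix(1)[OF c(2)] nofix(2)[OF c(2)]
  \<comment> \<open>At \<open>h = b\<close> the equation \<open>E\<close> contains a nonzero term
    whose balancing leaves only these two possibilities; \<open>d\<close>, \<open>a\<close> and
    \<open>c\<close> are treated alike.\<close>
  have b_cases: "b = d \<or> b = s \<otimes> c" using E[OF a(2)] ne nofix' by (auto simp: of_bool_def split: if_splits)
  have d_cases: "d = b \<or> d = t \<otimes> a" using E[OF c(2)] ne nofix' by (auto simp: of_bool_def split: if_splits)
  have a_cases: "a = c \<or> a = s \<otimes> d" using E[OF car(1)] ne nofix' by (auto simp: of_bool_def split: if_splits)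
  have c_cases: "c = a \<or> c = t \<otimes> b" using E[OF car(2)] ne nofix' by (auto simp: of_bool_def split: if_splits)
  show ?thesis
  proof (cases "b = d")
    case True
    have "a \<noteq> c"
    proof
      assume ac: "a = c"
      \<comment> \<open>With \<open>a = c\<close> and \<open>b = d\<close>, once equal terms cancel,
        \<open>E\<close> at \<open>s \<otimes> b\<close> has 1 on the right and nothing positive on
        the left.\<close>
      have "s \<otimes> b \<noteq> s \<otimes> a" using s a car ne by simp
      moreover have "s \<otimes> b \<noteq> t \<otimes> b" using s t a(2) st by (simp add: m_comm[of _ b])
      ultimately show False using E[of "s \<otimes> b"] True ac s a by (auto simp: of_bool_def split: if_splits)
    qed
    then show ?thesis using True a_cases c_cases by auto
  next
    case False
    then have bd: "b = s \<otimes> c" "d = t \<otimes> a" using b_cases d_cases by auto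
    have "a = c"
    proof (rule ccontr)
      assume "a \<noteq> c"
      then have "a = s \<otimes> (t \<otimes> a)" using a_cases bd by simp
      then have "a = (s \<otimes> t) \<otimes> a" using s t car by (simp add: m_assoc)
      then show False using st(2) s(1) t(1) car r_cancel_one'[of a "s \<otimes> t"] by simp
    qed
    then show ?thesis using bd by simp
  qed
qed


lemma subprods_subset_if_stable:
  assumes "\<one> \<in> B" "\<And>s. s \<in> set xs \<Longrightarrow> (\<lambda>y. s \<otimes> y) ` B = B"
  shows "subprods G xs \<subseteq> B"
  using assms(2)
proof (induction xs)
  case (Cons x xs)
  then have "subprods G xs \<subseteq> B" "(\<lambda>y. x \<otimes> y) ` B = B" by auto
  then show ?case by auto
qed (use assms(1) in simp)

lemma translate_generate:
  assumes "S \<subseteq> carrier G" "C \<subseteq> carrier G" "\<And>s. s \<in> S \<Longrightarrow> (\<lambda>y. s \<otimes> y) ` C = C" "g \<in> generate G S"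
  shows "(\<lambda>y. g \<otimes> y) ` C = C"
  using assms(4)
proof (induction g)
  case one
  then show ?case by (rule translate_one[OF assms(2)])
next
  case (incl h)
  then show ?case by (rule assms(3))
next
  case (inv h)
  then have "h \<in> carrier G" using assms(1) by blast
  then show ?case using translate_inv[OF assms(2)] assms(3)[OF inv] by blast
next
  case (eng h1 h2)
  then show ?case
    using translate_translate[OF generate_in_carrier[OF assms(1)] generate_in_carrier[OF assms(1)] assms(2), of h1 h2]
    by simp
qed

text \<open>
  If deleting any single element costs at most one product, then translating the product set by an
  element exchanges just one point. Two such exchanges with non-parallel elements either share the
  point that leaves, which then is isolated, or the point that enters, which then is the only
  point missing from a subgroup.
\<close>

lemma card_generate_if_small_steps:
  assumes xs: "set xs \<subseteq> carrier G" "\<one> \<notin> set xs" "aperiodic G (subprods G xs)"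
    and drop: "\<And>s. s \<in> set xs \<Longrightarrow> card (subprods G xs) \<le> card (subprods G (remove1 s xs)) + 1"
    and nc: "\<not> in_cyclic G (set xs)"
  shows "card (generate G (set xs)) = card (subprods G xs) + 1"
proof -
  define A where "A = subprods G xs"
  have A: "A \<subseteq> carrier G" "finite A" "\<one> \<in> A" using subprods_carrier xs by (auto simp: A_def)
  have ap: "v = \<one>" if "v \<in> carrier G" "(\<lambda>y. v \<otimes> y) ` A = A" for v
    using that xs(3) unfolding aperiodic_def A_def by blast
  have split: "A = subprods G (remove1 s xs) \<union> (\<lambda>y. s \<otimes> y) ` subprods G (remove1 s xs)"
    if "s \<in> set xs" for s using subprods_remove1[OF xs(1) that] by (simp add: A_def)
  \<comment> \<open>If \<open>s \<otimes> s\<close> were \<one>, the union of \<open>B\<close> and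
    its translate by \<open>s\<close> would be fixed by \<open>s\<close>.\<close>
  have sq: "s \<otimes> s \<noteq> \<one>" if s: "s \<in> set xs" for s
  proof
    assume "s \<otimes> s = \<one>"
    define B where "B = subprods G (remove1 s xs)"
    have B: "B \<subseteq> carrier G"
      using subprods_carrier[of "remove1 s xs"] xs(1) set_remove1_subset[of s xs] unfolding B_def by blast
    have sc: "s \<in> carrier G" using s xs by blast
    have "(\<lambda>y. s \<otimes> y) ` A = (\<lambda>y. s \<otimes> y) ` B \<union> (\<lambda>y. s \<otimes> y) ` (\<lambda>y. s \<otimes> y) ` B"
      using split[OF s] by (simp add: B_def image_Un)
    also have "\<dots> = A"
      using translate_translate[OF sc sc B] translate_one[OF B] \<open>s \<otimes> s = \<one>\<close> split[OF s]
      by (simp add: B_def Un_commute)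
    finally have "(\<lambda>y. s \<otimes> y) ` A = A" .
    then show False using ap s xs by blast
  qed
  have "\<exists>a b. a \<in> A \<and> b \<in> carrier G \<and> b \<notin> A \<and> (\<lambda>y. s \<otimes> y) ` A = insert b (A - {a})"
    if s: "s \<in> set xs" for s
  proof -
    have s': "s \<in> carrier G" "s \<noteq> \<one>" using s xs by auto
    have "card A \<le> card (subprods G (remove1 s xs)) + 1" using drop[OF s] by (simp add: A_def)
    then show ?thesis
      by (rule translate_exchange[OF A(2,1) xs(3)[folded A_def] s' split[OF s]]) blast
  qed
  then obtain a b where ab: "\<And>s. s \<in> set xs \<Longrightarrow>
      a s \<in> A \<and> b s \<in> carrier G \<and> b s \<notin> A \<and> (\<lambda>y. s \<otimes> y) ` A = insert (b s) (A - {a s})"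
    by metis
  have ab1: "a s \<in> A" and ab2: "b s \<in> carrier G" and ab3: "b s \<notin> A"
    and ab4: "(\<lambda>y. s \<otimes> y) ` A = insert (b s) (A - {a s})" if "s \<in> set xs" for s
    using ab[OF that] by simp_all
  have "set xs \<noteq> {}"
  proof
    assume "set xs = {}"
    then have "set xs \<subseteq> generate G {\<one>}" by simp
    then show False using nc one_closed unfolding in_cyclic_def by blast
  qed
  then obtain s0 where s0: "s0 \<in> set xs" by (meson ex_in_conv)
  then have s0c: "s0 \<in> carrier G" "s0 \<noteq> \<one>" using xs by auto
  have par: "s = s0 \<or> s = inv s0" if "s \<in> set xs" "s0 = s \<or> s0 \<otimes> s = \<one>" for s
    using that xs(1) s0c inv_equality[of s s0] m_comm[of s s0] by auto
  \<comment> \<open>If all entries were \<open>s0\<close> or its inverse, they would lie in a cyclic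
    subgroup.\<close>
  have "\<exists>s1\<in>set xs. s0 \<noteq> s1 \<and> s0 \<otimes> s1 \<noteq> \<one>"
  proof (rule ccontr)
    assume "\<not> ?thesis"
    then have "set xs \<subseteq> generate G {s0}" using par by (blast intro: generate.incl generate.inv)
    then show False using nc s0c unfolding in_cyclic_def by blast
  qed
  then obtain s1 where s1: "s1 \<in> set xs" "s0 \<noteq> s1" "s0 \<otimes> s1 \<noteq> \<one>" by blast
  have types: "(a s0 = a s \<and> b s0 = s0 \<otimes> a s0 \<and> b s = s \<otimes> a s) \<or>
      (b s0 = b s \<and> a s0 = s0 \<otimes> b s0 \<and> a s = s \<otimes> b s)"
    if s: "s \<in> set xs" "s0 \<noteq> s" "s0 \<otimes> s \<noteq> \<one>" for s
  proof -
    have t: "s \<in> carrier G" "s \<noteq> \<one>" using s(1) xs by auto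
    show ?thesis
      by (rule translate_exchange_commute[OF A(1) s0c t s(2,3) ab1[OF s0] ab2[OF s0] ab3[OF s0] ab4[OF s0]
            ab1[OF s(1)] ab2[OF s(1)] ab3[OF s(1)] ab4[OF s(1)]])
  qed
  \<comment> \<open>The two types together would make \<open>s0\<close> an involution. Hence
    \<open>s0\<close> is of the same type with respect to all entries that are not parallel to
    it.\<close>
  have excl: "\<not> (b s0 = s0 \<otimes> a s0 \<and> a s0 = s0 \<otimes> b s0)"
  proof
    assume "b s0 = s0 \<otimes> a s0 \<and> a s0 = s0 \<otimes> b s0"
    then have b: "b s0 = s0 \<otimes> a s0" and a: "a s0 = s0 \<otimes> b s0" by blast+
    have ac: "a s0 \<in> carrier G" using ab1[OF s0] A by blast
    moreover have "a s0 = (s0 \<otimes> s0) \<otimes> a s0" using a s0c(1) ac unfolding b by (simp only: m_assoc)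
    ultimately show False using sq[OF s0] s0c r_cancel_one'[of "a s0" "s0 \<otimes> s0"] by simp
  qed
  consider "b s0 = s0 \<otimes> a s0" | "a s0 = s0 \<otimes> b s0" using types[OF s1] by blast
  then show ?thesis
  proof cases
    case 1
    \<comment> \<open>The shared point that leaves is \<open>a s0\<close>, and the rest
      \<open>B\<close> is fixed by every entry. If \<one> is in \<open>B\<close>, so are all
      subproducts, even \<open>a s0\<close>; otherwise \<open>s0\<close> is in \<open>B\<close>, and
      with it \<open>inv s0 \<otimes> s0\<close>.\<close>
    define B where "B = A - {a s0}"
    have B: "B \<subseteq> carrier G" using A by (auto simp: B_def)
    have stab: "(\<lambda>y. s \<otimes> y) ` B = B" if s: "s \<in> set xs" "a s = a s0" "b s = s \<otimes> a s" for s
    proof -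
      have sc: "s \<in> carrier G" using s(1) xs(1) by blast
      have "{a s} \<subseteq> carrier G" using ab1[OF s(1)] A(1) by blast
      then have "(\<lambda>y. s \<otimes> y) ` (A - {a s}) = (\<lambda>y. s \<otimes> y) ` A - {s \<otimes> a s}"
        using inj_on_image_set_diff[OF inj_on_cmult[OF sc], of A "{a s}"] A(1) by blast
      also have "\<dots> = A - {a s}"
        unfolding ab4[OF s(1)] s(3)[symmetric] using ab3[OF s(1)] by blast
      finally show ?thesis unfolding B_def s(2) .
    qed
    have st0: "(\<lambda>y. s0 \<otimes> y) ` B = B" by (rule stab[OF s0 refl 1])
    have all: "(\<lambda>y. s \<otimes> y) ` B = B" if s: "s \<in> set xs" for s
    proof (cases "s0 = s \<or> s0 \<otimes> s = \<one>")
      case True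
      then show ?thesis using par[OF s True] st0 translate_inv[OF B s0c(1) st0] by auto
    next
      case False
      then have "a s = a s0" "b s = s \<otimes> a s" using types[OF s] excl 1 by auto
      then show ?thesis by (rule stab[OF s])
    qed
    show ?thesis
    proof (cases "\<one> \<in> B")
      case True
      then have "A \<subseteq> B" using subprods_subset_if_stable all by (simp add: A_def)
      then show ?thesis using ab1[OF s0] by (auto simp: B_def)
    next
      case False
      then have "s0 \<in> B" using mem_subprods[OF xs(1) s0] A(3) s0c by (auto simp: B_def A_def)
      then have "inv s0 \<otimes> s0 \<in> B" using translate_inv[OF B s0c(1) st0] by blast
      then show ?thesis using False s0c by simp
    qed
  next
    case 2
    \<comment> \<open>The shared point that enters completes \<open>A\<close> to a set fixed by
      every entry, and this set is the subgroup that the entries generate.\<close>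
    define C where "C = insert (b s0) A"
    have C: "C \<subseteq> carrier G" "\<one> \<in> C" using A ab2[OF s0] by (auto simp: C_def)
    have stab: "(\<lambda>y. s \<otimes> y) ` C = C" if s: "s \<in> set xs" "b s = b s0" "a s = s \<otimes> b s" for s
      unfolding C_def image_insert ab4[OF s(1)] s(2,3)[symmetric] using ab1[OF s(1)] s(3) by auto
    have st0: "(\<lambda>y. s0 \<otimes> y) ` C = C" by (rule stab[OF s0 refl 2])
    have all: "(\<lambda>y. s \<otimes> y) ` C = C" if s: "s \<in> set xs" for s
    proof (cases "s0 = s \<or> s0 \<otimes> s = \<one>")
      case True
      then show ?thesis using par[OF s True] st0 translate_inv[OF C(1) s0c(1) st0] by auto
    next
      case False
      then have "b s = b s0" "a s = s \<otimes> b s" using types[OF s] excl 2 by auto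
      then show ?thesis by (rule stab[OF s])
    qed
    have gen_C: "generate G (set xs) \<subseteq> C"
    proof
      fix g assume g: "g \<in> generate G (set xs)"
      then have "(\<lambda>y. g \<otimes> y) ` C = C" using translate_generate[OF xs(1) C(1) all] by blast
      then have "g \<otimes> \<one> \<in> C" using C(2) by blast
      then show "g \<in> C" using generate_in_carrier[OF xs(1) g] by simp
    qed
    have A_gen: "A \<subseteq> generate G (set xs)"
      unfolding A_def by (intro subprods_mem_generate) (auto intro: generate.incl)
    have "A \<noteq> generate G (set xs)"
    proof
      assume eq: "A = generate G (set xs)"
      have "(\<lambda>y. s0 \<otimes> y) ` A \<subseteq> A" unfolding eq using generate.eng[OF generate.incl[OF s0]] by blast
      then show False using ap translate_subset_eq A s0c by blast
    qed
    then have "generate G (set xs) = insert (b s0) A" using gen_C A_gen unfolding C_def by blast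
    then show ?thesis using ab3[OF s0] A(2) unfolding A_def[symmetric] by simp
  qed
qed

section \<open>Lower bounds for the number of subproducts\<close>

lemma card_growing_Cons:
  assumes "set xs \<subseteq> carrier G" "x \<in> carrier G" "growing G (x # xs)"
  shows "card (subprods G xs) < card (subprods G (x # xs))"
proof -
  have "subprods G xs \<subseteq> carrier G" using subprods_carrier assms by simp
  then have "\<not> (\<lambda>y. x \<otimes> y) ` subprods G xs \<subseteq> subprods G xs"
    using translate_subset_eq[OF finite_subprods _ assms(2)] assms(3) by auto
  then show ?thesis by (intro psubset_card_mono) auto
qed

lemma in_cyclic_short: "set xs \<subseteq> carrier G \<Longrightarrow> length xs \<le> 1 \<Longrightarrow> in_cyclic G (set xs)"
proof (cases xs)
  case Nil
  then have "set xs \<subseteq> generate G {\<one>}" by simp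
  then show ?thesis unfolding in_cyclic_def using one_closed by blast
next
  case (Cons x ys)
  moreover assume "set xs \<subseteq> carrier G" "length xs \<le> 1"
  ultimately have x: "x \<in> carrier G" and "set xs = {x}" by auto
  then have "set xs \<subseteq> generate G {x}" using generate.incl[of x "{x}" G] by simp
  then show ?thesis unfolding in_cyclic_def using x by blast
qed

text \<open>If deleting some element costs two products, induction applies directly. If no deletion
  does, \<open>card_generate_if_small_steps\<close> shows that just one element of the generated
  subgroup is missed. This exception does not accumulate: a further element inside the subgroup
  would fill it, against aperiodicity, and one outside doubles the set.\<close>

lemma card_aperiodic_subprods:
  assumes "set xs \<subseteq> carrier G" "\<one> \<notin> set xs" "aperiodic G (subprods G xs)" "\<not> in_cyclic G (set xs)"
  shows "2 * length xs \<le> card (subprods G xs) \<or>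
    (2 * length xs \<le> card (subprods G xs) + 1 \<and> card (generate G (set xs)) = card (subprods G xs) + 1)"
  using assms
proof (induction xs rule: length_induct)
  case (1 xs)
  note xs = "1.prems"
  define A where "A = subprods G xs"
  have "set xs \<noteq> {}" using xs(1,4) in_cyclic_short[of xs] by auto
  \<comment> \<open>Choose an element whose deletion costs two products if there is one, and any
    element otherwise.\<close>
  have "\<exists>s\<in>set xs. card A \<ge> card (subprods G (remove1 s xs)) + 2 \<or>
      (\<forall>s\<in>set xs. card A \<le> card (subprods G (remove1 s xs)) + 1)"
  proof (cases "\<exists>s\<in>set xs. card A \<ge> card (subprods G (remove1 s xs)) + 2")
    case False
    then have "\<forall>s\<in>set xs. \<not> card (subprods G (remove1 s xs)) + 2 \<le> card A" by blast
    then have "\<forall>s\<in>set xs. card A \<le> card (subprods G (remove1 s xs)) + 1"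
      by (simp only: not_le) fastforce
    then show ?thesis using \<open>set xs \<noteq> {}\<close> by (meson ex_in_conv)
  qed blast
  then obtain s where s: "s \<in> set xs" and s_drop: "card A \<ge> card (subprods G (remove1 s xs)) + 2 \<or>
      (\<forall>s\<in>set xs. card A \<le> card (subprods G (remove1 s xs)) + 1)" by blast
  define ys where "ys = remove1 s xs"
  have sc: "s \<in> carrier G" "s \<noteq> \<one>" using s xs by auto
  have ys: "set ys \<subseteq> carrier G" "\<one> \<notin> set ys"
    using xs unfolding ys_def by (auto dest: notin_set_remove1)
  have A: "A = subprods G (s # ys)" using subprods_remove1[OF xs(1) s] by (simp add: A_def ys_def)
  have ap: "aperiodic G (subprods G (s # ys))" using xs(3) A A_def by simp
  have gr: "growing G (s # ys)" using growing_if_aperiodic[OF _ _ ap] sc ys by auto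
  have ap': "aperiodic G (subprods G ys)" using aperiodic_tail[OF _ ap] sc ys by simp
  have len: "length xs = length ys + 1" using s length_pos_if_in_set[OF s] by (simp add: ys_def length_remove1)
  have "mset xs = mset (s # ys)" using s by (simp add: ys_def)
  then have sets: "set xs = insert s (set ys)" using mset_eq_setD[of xs "s # ys"] by simp
  have lt: "card (subprods G ys) < card A" using card_growing_Cons[OF ys(1) sc(1) gr] A by simp
  show ?case
  proof (cases "in_cyclic G (set ys)")
    case True
    then obtain g where g: "g \<in> carrier G" "set ys \<subseteq> generate G {g}" unfolding in_cyclic_def by blast
    have "s \<notin> generate G {g}"
    proof
      assume "s \<in> generate G {g}"
      then have "set xs \<subseteq> generate G {g}" using g(2) unfolding sets by simp
      then show False using xs(4) g(1) unfolding in_cyclic_def by blast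
    qed
    then have "card A = 2 * card (subprods G ys)" using card_subprods_Cons_outside g sc A by simp
    moreover have "card (subprods G ys) \<ge> length ys + 1" using card_growing ys gr by simp
    ultimately show ?thesis using len A_def by simp
  next
    case False
    \<comment> \<open>In the doubling case below, \<open>2 * (2 * n - 1) \<ge> 2 * (n + 1)\<close>
      for \<open>n = length ys\<close> requires \<open>n \<ge> 2\<close>.\<close>
    have len2: "length ys \<ge> 2" using in_cyclic_short[OF ys(1)] False by linarith
    have IH: "2 * length ys \<le> card (subprods G ys) \<or>
      (2 * length ys \<le> card (subprods G ys) + 1 \<and> card (generate G (set ys)) = card (subprods G ys) + 1)"
      using 1(1) len ys ap' False by simp
    then show ?thesis
    proof
      assume *: "2 * length ys \<le> card (subprods G ys)"
      show ?thesis
      proof (cases "card A \<ge> card (subprods G ys) + 2")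
        case True
        then show ?thesis using * len A_def by simp
      next
        case False
        then have "\<forall>s\<in>set xs. card A \<le> card (subprods G (remove1 s xs)) + 1"
          using s_drop by (simp add: ys_def)
        then have "card (generate G (set xs)) = card A + 1"
          using card_generate_if_small_steps[OF xs(1-3) _ xs(4)] A_def by simp
        then show ?thesis using * len lt A_def by simp
      qed
    next
      assume *: "2 * length ys \<le> card (subprods G ys) + 1 \<and> card (generate G (set ys)) = card (subprods G ys) + 1"
      show ?thesis
      proof (cases "s \<in> generate G (set ys)")
        case True
        \<comment> \<open>The set has grown inside the subgroup, so the single missing element is
          now present; but the full subgroup is fixed by \<open>s\<close>.\<close>
        have sub: "A \<subseteq> generate G (set ys)"
          unfolding A by (intro subprods_mem_generate) (auto intro: generate.incl True)
        have "finite (generate G (set ys))" using * card.infinite by fastforce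
        then have eq: "A = generate G (set ys)" using sub * lt by (intro card_seteq) auto
        have "(\<lambda>y. s \<otimes> y) ` A \<subseteq> A" unfolding eq using generate.eng[OF True] by blast
        moreover have "A \<subseteq> carrier G" using subprods_carrier xs by (simp add: A_def)
        moreover have "finite A" by (simp add: A_def)
        ultimately have "(\<lambda>y. s \<otimes> y) ` A = A" using translate_subset_eq sc by blast
        then show ?thesis using ap sc A unfolding aperiodic_def by auto
      next
        case False
        then have "card A = 2 * card (subprods G ys)"
          using card_subprods_Cons_outside[OF _ ys(1) sc(1) False] A by (auto intro: generate.incl)
        then show ?thesis using * len len2 A_def by simp
      qed
    qed
  qed
qed

lemma one_notin_growing: "set xs \<subseteq> carrier G \<Longrightarrow> growing G xs \<Longrightarrow> \<one> \<notin> set xs"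
proof (induction xs)
  case (Cons x xs)
  then show ?case using translate_one[OF subprods_carrier[of xs]] by auto
qed simp

text \<open>Without aperiodicity the bound loses one unit, and at most once: as soon as a nontrivial
  \<open>v\<close> fixes the set, new products come in pairs \<open>a\<close>,
  \<open>v \<otimes> a\<close>, so every further growing step adds two.\<close>

lemma card_growing_noncyclic:
  assumes "set xs \<subseteq> carrier G" "growing G xs" "\<not> in_cyclic G (set xs)"
  shows "2 * length xs \<le> card (subprods G xs) + 2 \<and>
    (aperiodic G (subprods G xs) \<longrightarrow> 2 * length xs \<le> card (subprods G xs) + 1)"
  using assms
proof (induction xs)
  case Nil
  then show ?case using in_cyclic_short[of "[]"] by simp
next
  case (Cons x xs)
  define A where "A = subprods G (x # xs)"
  have x: "x \<in> carrier G" and xs: "set xs \<subseteq> carrier G" "growing G xs" using Cons.prems by auto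
  have lt: "card (subprods G xs) < card A"
    using card_growing_Cons[OF xs(1) x Cons.prems(2)] by (simp add: A_def)
  have sub: "subprods G xs \<subseteq> A" "subprods G xs \<subseteq> carrier G" "A \<subseteq> carrier G"
    using subprods_carrier[of xs] subprods_carrier[of "x # xs"] xs x by (auto simp: A_def)
  show ?case
  proof (cases "aperiodic G A")
    case True
    then show ?thesis
      using card_aperiodic_subprods[OF Cons.prems(1) one_notin_growing[OF Cons.prems(1,2)] _ Cons.prems(3)]
      by (auto simp: A_def)
  next
    case False
    then obtain v where v: "v \<in> carrier G" "v \<noteq> \<one>" "(\<lambda>y. v \<otimes> y) ` A = A"
      unfolding aperiodic_def by blast
    show ?thesis
    proof (cases "in_cyclic G (set xs)")
      case True
      then obtain g where g: "g \<in> carrier G" "set xs \<subseteq> generate G {g}" unfolding in_cyclic_def by blast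
      have "x \<notin> generate G {g}"
      proof
        assume "x \<in> generate G {g}"
        then have "set (x # xs) \<subseteq> generate G {g}" using g(2) by simp
        then show False using Cons.prems(3) g(1) unfolding in_cyclic_def by blast
      qed
      then have "card A = 2 * card (subprods G xs)"
        using card_subprods_Cons_outside g x by (simp add: A_def)
      then show ?thesis using card_growing[OF xs] by (simp add: A_def)
    next
      case nc: False
      show ?thesis
      proof (cases "aperiodic G (subprods G xs)")
        case True
        \<comment> \<open>The step at which the set becomes periodic may add only one product; the
          stronger bound for the aperiodic tail absorbs this.\<close>
        then show ?thesis using Cons.IH[OF xs nc] lt False by (simp add: A_def)
      next
        case False
        then obtain v where v: "v \<in> carrier G" "v \<noteq> \<one>" "(\<lambda>y. v \<otimes> y) ` subprods G xs = subprods G xs"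
          unfolding aperiodic_def by blast
        have vA: "(\<lambda>y. v \<otimes> y) ` A = A" using stable_subprods[OF xs(1) x v(1,3)] by (simp add: A_def)
        obtain a where a: "a \<in> A" "a \<notin> subprods G xs"
          using lt sub(1) by (metis less_irrefl subsetI subset_antisym)
        have ac: "a \<in> carrier G" using a sub by blast
        have "v \<otimes> a \<notin> subprods G xs"
        proof
          assume "v \<otimes> a \<in> subprods G xs"
          then have "inv v \<otimes> (v \<otimes> a) \<in> subprods G xs" using translate_inv[OF sub(2) v(1,3)] by blast
          then show False using a ac v by (simp flip: m_assoc)
        qed
        then have "{a, v \<otimes> a} \<subseteq> A - subprods G xs" using a vA by blast
        moreover have "v \<otimes> a \<noteq> a" using ac v by simp
        moreover have "finite (A - subprods G xs)" by (simp add: A_def)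
        ultimately have "card {a, v \<otimes> a} \<le> card (A - subprods G xs)" "card {a, v \<otimes> a} = 2"
          using card_mono by (blast, simp)
        then have "card A \<ge> card (subprods G xs) + 2"
          using sub(1) by (simp add: card_Diff_subset)
        then show ?thesis using Cons.IH[OF xs nc] False \<open>\<not> aperiodic G A\<close> by (simp add: A_def)
      qed
    qed
  qed
qed

text \<open>If the entries lie in a cyclic subgroup, it is proper, so it has at most half of the
  elements and no room for so many growing steps. Otherwise \<open>card_growing_noncyclic\<close>
  yields at least \<open>order G\<close> subproducts.\<close>

lemma growing_full:
  assumes "finite (carrier G)" "\<not> in_cyclic G (carrier G)" "set xs \<subseteq> carrier G" "growing G xs"
    "order G + 2 \<le> 2 * length xs"
  shows "subprods G xs = carrier G"
proof (cases "in_cyclic G (set xs)")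
  case True
  then obtain g where g: "g \<in> carrier G" "set xs \<subseteq> generate G {g}" unfolding in_cyclic_def by blast
  have sg: "subgroup (generate G {g}) G" using g by (intro generate_is_subgroup) auto
  have "generate G {g} \<noteq> carrier G" using assms(2) g unfolding in_cyclic_def by blast
  then have "generate G {g} \<subset> carrier G" using subgroup.subset[OF sg] by blast
  then have lt: "card (generate G {g}) < order G"
    using assms(1) psubset_card_mono unfolding order_def by blast
  have "card (generate G {g}) dvd order G" using lagrange[OF sg] by (metis dvd_triv_right)
  then obtain m where m: "order G = card (generate G {g}) * m" by (auto simp: dvd_def)
  then have "m \<noteq> 0" "m \<noteq> 1" using lt by auto
  then have "m \<ge> 2" by simp
  then have "card (generate G {g}) * 2 \<le> order G" unfolding m by (rule mult_le_mono2)
  moreover have "card (subprods G xs) \<le> card (generate G {g})"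
    using subprods_mem_generate[OF g(2)] lt assms(1) subgroup.subset[OF sg]
    by (intro card_mono) (auto intro: finite_subset)
  ultimately show ?thesis using card_growing[OF assms(3,4)] assms(5) by linarith
next
  case False
  have le: "card (subprods G xs) \<le> order G"
    using subprods_carrier[OF assms(3)] assms(1) unfolding order_def by (intro card_mono)
  have "order G \<le> card (subprods G xs)"
    using card_growing_noncyclic[OF assms(3,4) False] assms(5) by linarith
  then show ?thesis using subprods_carrier[OF assms(3)] assms(1) unfolding order_def by (intro card_seteq)
qed

end

section \<open>Extracting marked elements\<close>

text \<open>
  Boolean functions with inequality as addition stand for the group algebra over the field with two
  elements; \<open>difference G x\<close> is the multiplication by \<open>1 - x\<close>.
\<close>

definition difference :: "('a, 'b) monoid_scheme \<Rightarrow> 'a \<Rightarrow> ('a \<Rightarrow> bool) \<Rightarrow> 'a \<Rightarrow> bool" where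
  "difference G x \<phi> h \<longleftrightarrow> h \<in> carrier G \<and> \<phi> h \<noteq> \<phi> (inv\<^bsub>G\<^esub> x \<otimes>\<^bsub>G\<^esub> h)"

primrec differences :: "('a, 'b) monoid_scheme \<Rightarrow> 'a list \<Rightarrow> ('a \<Rightarrow> bool) \<Rightarrow> 'a \<Rightarrow> bool" where
  "differences G [] \<phi> = \<phi>"
| "differences G (x # xs) \<phi> = difference G x (differences G xs \<phi>)"

context comm_group
begin

section \<open>Extraction while the set of subproducts grows\<close>

text \<open>The set \<open>Q\<close> collects the marked elements to be discarded. A marked element
  whose inverse enlarges the set is removed from \<open>Y\<close>, and the inverse is put into
  \<open>xs\<close>. This ends when \<open>k\<close> elements are left, and then \<open>xs\<close>
  has length at least \<open>L\<close>, or when the remaining elements all fix the set. On the way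
  back, a removed element joins \<open>Q\<close> if its inverse was used.\<close>

lemma growing_extract_aux:
  assumes "finite Y" "g \<in> Y \<rightarrow> carrier G" "set xs \<subseteq> carrier G" "growing G xs" "c \<in> carrier G"
    and "c \<otimes> finprod G g Y \<in> subprods G xs"
    and "L + k \<le> length xs + card Y" "k \<le> card Y"
    and full: "\<And>zs. set zs \<subseteq> carrier G \<Longrightarrow> growing G zs \<Longrightarrow> L \<le> length zs \<Longrightarrow> subprods G zs = carrier G"
  shows "\<exists>Q\<subseteq>Y. card Q + k \<le> card Y \<and> c \<otimes> finprod G g Q \<in> subprods G xs"
  using assms(1-8)
proof (induction "card Y - k" arbitrary: Y xs)
  case 0
  then have "card Y = k" by simp
  then have "subprods G xs = carrier G" using 0 full by simp
  then show ?case using 0(6,9) by (intro exI[of _ "{}"]) simp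
next
  case (Suc m)
  show ?case
  proof (cases "\<forall>y\<in>Y. (\<lambda>z. g y \<otimes> z) ` subprods G xs = subprods G xs")
    case True
    have sub: "subprods G xs \<subseteq> carrier G" using subprods_carrier Suc.prems by blast
    \<comment> \<open>The product of elements fixing the set fixes it too, so all of
      \<open>Y\<close> can be kept.\<close>
    have "(\<lambda>z. finprod G g Y \<otimes> z) ` subprods G xs = subprods G xs"
      using Suc.prems(1,2) True
    proof (induction Y)
      case empty
      then show ?case using translate_one[OF sub] by simp
    next
      case (insert y Y)
      then have y: "g y \<in> carrier G" "finprod G g Y \<in> carrier G" by auto
      have "finprod G g (insert y Y) = g y \<otimes> finprod G g Y" using insert by (intro finprod_insert) auto
      then show ?case using translate_translate[OF y sub] insert by simp
    qed
    then have "(\<lambda>z. inv (finprod G g Y) \<otimes> z) ` subprods G xs = subprods G xs"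
      using Suc.prems by (intro translate_inv[OF sub]) auto
    then have "inv (finprod G g Y) \<otimes> (c \<otimes> finprod G g Y) \<in> subprods G xs" using Suc.prems by blast
    moreover have "inv (finprod G g Y) \<otimes> (c \<otimes> finprod G g Y) = c"
      using Suc.prems(2,5) by (simp add: m_lcomm[of _ c])
    ultimately have "c \<otimes> finprod G g {} \<in> subprods G xs" using Suc.prems(5) by simp
    then show ?thesis using Suc.prems(8) by (intro exI[of _ "{}"]) simp
  next
    case False
    then obtain y where y: "y \<in> Y" "(\<lambda>z. g y \<otimes> z) ` subprods G xs \<noteq> subprods G xs" by blast
    have sub: "subprods G xs \<subseteq> carrier G" using subprods_carrier Suc.prems by blast
    have gy: "g y \<in> carrier G" using y Suc.prems by blast
    define Y' where "Y' = Y - {y}"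
    have Y': "finite Y'" "g \<in> Y' \<rightarrow> carrier G" "y \<notin> Y'" "Y = insert y Y'"
      using Suc.prems y by (auto simp: Y'_def)
    have cY: "card Y = Suc (card Y')" using Y' by simp
    have fin: "finprod G g Y = g y \<otimes> finprod G g Y'" using Y' gy by simp
    have "(\<lambda>z. inv (g y) \<otimes> z) ` subprods G xs \<noteq> subprods G xs"
      using translate_inv[OF sub, of "inv (g y)"] gy y(2) by auto
    then have gr: "growing G (inv (g y) # xs)" using Suc.prems by simp
    have fc: "finprod G g Y' \<in> carrier G" using Y' by simp
    have "inv (g y) \<otimes> (c \<otimes> finprod G g Y) = c \<otimes> finprod G g Y'"
    proof -
      have "inv (g y) \<otimes> (c \<otimes> (g y \<otimes> finprod G g Y')) = c \<otimes> (inv (g y) \<otimes> (g y \<otimes> finprod G g Y'))"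
        using gy fc Suc.prems(5) by (simp add: m_lcomm)
      also have "inv (g y) \<otimes> (g y \<otimes> finprod G g Y') = finprod G g Y'"
        using gy fc by (simp flip: m_assoc)
      finally show ?thesis using fin by simp
    qed
    moreover have "inv (g y) \<otimes> (c \<otimes> finprod G g Y) \<in> (\<lambda>z. inv (g y) \<otimes> z) ` subprods G xs"
      using Suc.prems(6) by blast
    ultimately have mem: "c \<otimes> finprod G g Y' \<in> subprods G (inv (g y) # xs)" by simp
    have set': "set (inv (g y) # xs) \<subseteq> carrier G" using gy Suc.prems(3) by simp
    have "\<exists>Q\<subseteq>Y'. card Q + k \<le> card Y' \<and> c \<otimes> finprod G g Q \<in> subprods G (inv (g y) # xs)"
      using Suc.hyps(2) Suc.prems(7,8) cY by (intro Suc.hyps(1)[OF _ Y'(1,2) set' gr Suc.prems(5) mem]) auto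
    then obtain Q where Q: "Q \<subseteq> Y'" "card Q + k \<le> card Y'" "c \<otimes> finprod G g Q \<in> subprods G (inv (g y) # xs)"
      by blast
    from Q(3) consider "c \<otimes> finprod G g Q \<in> subprods G xs"
      | a where "a \<in> subprods G xs" "c \<otimes> finprod G g Q = inv (g y) \<otimes> a" by auto
    then show ?thesis
    proof cases
      case 1
      moreover have "Q \<subseteq> Y" "card Q + k \<le> card Y" using Q(1,2) Y'(4) cY by auto
      ultimately show ?thesis by blast
    next
      case 2
      have finQ: "finite Q" "g \<in> Q \<rightarrow> carrier G" "y \<notin> Q" using Q(1) Y'(2,3) finite_subset[OF Q(1) Y'(1)] by auto
      have "c \<otimes> finprod G g (insert y Q) = g y \<otimes> (c \<otimes> finprod G g Q)"
        using finQ gy Suc.prems(5) by (simp add: m_lcomm)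
      also have "\<dots> = a"
      proof -
        have "a \<in> carrier G" using 2(1) sub by blast
        then show ?thesis unfolding 2(2) using gy by (simp flip: m_assoc)
      qed
      finally have "c \<otimes> finprod G g (insert y Q) \<in> subprods G xs" using 2 by simp
      moreover have "card (insert y Q) + k \<le> card Y" using cY Q(2) finQ by simp
      moreover have "insert y Q \<subseteq> Y" using Q(1) Y'(4) by blast
      ultimately show ?thesis by blast
    qed
  qed
qed

text \<open>For \<open>c\<close> the inverse of the full product, \<open>c\<close> times the product
  over \<open>Q\<close> is the inverse of the product over the complement of
  \<open>Q\<close>.\<close>

lemma growing_extract:
  assumes "finite Y" "g \<in> Y \<rightarrow> carrier G" "set xs \<subseteq> carrier G" "growing G xs"
    and "L + k \<le> length xs + card Y" "k \<le> card Y"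
    and full: "\<And>zs. set zs \<subseteq> carrier G \<Longrightarrow> growing G zs \<Longrightarrow> L \<le> length zs \<Longrightarrow> subprods G zs = carrier G"
  shows "\<exists>Z\<subseteq>Y. k \<le> card Z \<and> inv (finprod G g Z) \<in> subprods G xs"
proof -
  define c where "c = inv (finprod G g Y)"
  have c: "c \<in> carrier G" "c \<otimes> finprod G g Y = \<one>" using assms(1,2) by (auto simp: c_def)
  have "\<exists>Q\<subseteq>Y. card Q + k \<le> card Y \<and> c \<otimes> finprod G g Q \<in> subprods G xs"
    using c by (intro growing_extract_aux[OF assms(1-4) c(1) _ assms(5,6) full]) auto
  then obtain Q where Q: "Q \<subseteq> Y" "card Q + k \<le> card Y" "c \<otimes> finprod G g Q \<in> subprods G xs" by blast
  define Z where "Z = Y - Q"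
  have sets: "finite Q" "finite Z" "g \<in> Q \<rightarrow> carrier G" "g \<in> Z \<rightarrow> carrier G" "Y = Z \<union> Q" "Z \<inter> Q = {}"
    using Q(1) assms(1,2) finite_subset[OF Q(1) assms(1)] by (auto simp: Z_def)
  have fc: "finprod G g Z \<in> carrier G" "finprod G g Q \<in> carrier G" using sets by auto
  have "finprod G g Y = finprod G g Z \<otimes> finprod G g Q"
    unfolding sets(5) using sets by (intro finprod_Un_disjoint)
  then have "c \<otimes> finprod G g Q = inv (finprod G g Z) \<otimes> (inv (finprod G g Q) \<otimes> finprod G g Q)"
    unfolding c_def using fc by (simp add: inv_mult m_assoc)
  then have "inv (finprod G g Z) \<in> subprods G xs" using Q(3) fc by simp
  moreover have "card Y = card Z + card Q"
    unfolding sets(5) using sets by (intro card_Un_disjoint)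
  moreover have "Z \<subseteq> Y" by (auto simp: Z_def)
  ultimately show ?thesis using Q(2) by (intro exI[of _ Z]) simp
qed

section \<open>Differences in the group algebra over the field with two elements\<close>

lemma difference_add: "difference G x (\<lambda>h. \<phi> h \<noteq> \<psi> h) = (\<lambda>h. difference G x \<phi> h \<noteq> difference G x \<psi> h)"
  by (auto simp: difference_def fun_eq_iff)

lemma difference_zero [simp]: "difference G x (\<lambda>h. False) = (\<lambda>h. False)"
  by (auto simp: difference_def fun_eq_iff)

lemma difference_commute:
  assumes "x \<in> carrier G" "y \<in> carrier G"
  shows "difference G x (difference G y \<phi>) = difference G y (difference G x \<phi>)"
  using assms by (auto simp: difference_def fun_eq_iff m_lcomm)

lemma difference_twice:
  assumes "x \<in> carrier G"
  shows "difference G x (difference G x \<phi>) = difference G (x \<otimes> x) \<phi>"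
  using assms by (auto simp: difference_def fun_eq_iff inv_mult m_assoc)

lemma difference_one [simp]: "difference G \<one> \<phi> = (\<lambda>h. False)"
  by (auto simp: difference_def fun_eq_iff)

lemma differences_append: "differences G (xs @ ys) \<phi> = differences G xs (differences G ys \<phi>)"
  by (induction xs) auto

lemma differences_difference:
  "set xs \<subseteq> carrier G \<Longrightarrow> x \<in> carrier G \<Longrightarrow>
    differences G xs (difference G x \<phi>) = difference G x (differences G xs \<phi>)"
  by (induction xs) (auto simp: difference_commute)

lemma funpow_difference_add:
  "(difference G x ^^ n) (\<lambda>h. \<phi> h \<noteq> \<psi> h) = (\<lambda>h. (difference G x ^^ n) \<phi> h \<noteq> (difference G x ^^ n) \<psi> h)"
  by (induction n) (simp_all only: funpow.simps o_apply difference_add id_apply)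

lemma funpow_difference_zero [simp]: "(difference G x ^^ n) (\<lambda>h. False) = (\<lambda>h. False)"
  by (induction n) auto

text \<open>Frobenius in characteristic two: \<open>(1 - x) ^ n = 1 - x ^ n\<close> for
  \<open>n = 2 ^ a\<close>.\<close>

lemma funpow_difference_two_power:
  assumes "x \<in> carrier G"
  shows "(difference G x ^^ (2 ^ a)) \<phi> = difference G (x [^] (2 ^ a :: nat)) \<phi>"
proof (induction a arbitrary: \<phi>)
  case (Suc a)
  have "(difference G x ^^ (2 ^ Suc a)) \<phi> = (difference G x ^^ (2 ^ a)) ((difference G x ^^ (2 ^ a)) \<phi>)"
    by (simp add: mult_2 funpow_add)
  also have "\<dots> = difference G (x [^] (2 ^ a :: nat) \<otimes> x [^] (2 ^ a :: nat)) \<phi>"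
    using assms by (simp add: Suc difference_twice)
  also have "x [^] (2 ^ a :: nat) \<otimes> x [^] (2 ^ a :: nat) = x [^] (2 ^ Suc a :: nat)"
    using assms by (simp add: nat_pow_mult mult_2)
  finally show ?case .
qed (use assms in simp)

text \<open>Multiplication by the group element \<open>x\<close> in the group algebra.\<close>

definition translated :: "'a \<Rightarrow> ('a \<Rightarrow> bool) \<Rightarrow> 'a \<Rightarrow> bool" where
  "translated x \<phi> h = (h \<in> carrier G \<and> \<phi> (inv x \<otimes> h))"

lemma translated_difference:
  "x \<in> carrier G \<Longrightarrow> y \<in> carrier G \<Longrightarrow> translated x (difference G y \<phi>) = difference G y (translated x \<phi>)"
  by (auto simp: translated_def difference_def fun_eq_iff m_lcomm)

lemma translated_funpow_difference:
  "x \<in> carrier G \<Longrightarrow> y \<in> carrier G \<Longrightarrow>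
    \<exists>\<psi>. translated x ((difference G y ^^ n) \<phi>) = (difference G y ^^ n) \<psi>"
  by (induction n) (auto simp: translated_difference)

text \<open>This is \<open>1 - x * y = (1 - x) + x * (1 - y)\<close>.\<close>

lemma difference_mult:
  assumes "x \<in> carrier G" "y \<in> carrier G"
  shows "difference G (x \<otimes> y) \<phi> = (\<lambda>h. difference G x \<phi> h \<noteq> translated x (difference G y \<phi>) h)"
proof
  fix h
  have "inv (x \<otimes> y) \<otimes> h = inv y \<otimes> (inv x \<otimes> h)" if "h \<in> carrier G"
    using assms that by (simp add: inv_mult_group m_assoc)
  then show "difference G (x \<otimes> y) \<phi> h = (difference G x \<phi> h \<noteq> translated x (difference G y \<phi>) h)"
    using assms by (auto simp: difference_def translated_def)
qed

text \<open>This is \<open>1 - 1 / x = - (1 - x) / x\<close>, where the sign disappears in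
  characteristic two.\<close>

lemma difference_inv:
  assumes "x \<in> carrier G"
  shows "difference G (inv x) \<phi> = translated (inv x) (difference G x \<phi>)"
  using assms by (auto simp: difference_def translated_def fun_eq_iff simp flip: m_assoc)

text \<open>
  If \<open>e\<close> has order at most 2 and \<open>e\<close>, \<open>f\<close> generate the group, this is the \<open>L\<close>-th power of the
  augmentation ideal.
\<close>

definition deep :: "'a \<Rightarrow> 'a \<Rightarrow> nat \<Rightarrow> ('a \<Rightarrow> bool) \<Rightarrow> bool" where
  "deep e f L \<phi> \<longleftrightarrow> (\<exists>\<psi>1 \<psi>2. \<phi> = (\<lambda>h. (difference G f ^^ L) \<psi>1 h \<noteq>
      difference G e ((difference G f ^^ (L - 1)) \<psi>2) h))"

lemma deep_0: "deep e f 0 \<phi>"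
  unfolding deep_def by (intro exI[of _ \<phi>] exI[of _ "\<lambda>h. False"]) simp

lemma deep_zero: "deep e f L (\<lambda>h. False)"
  unfolding deep_def by (intro exI[of _ "\<lambda>h. False"]) simp

lemma deep_add:
  assumes "deep e f L \<phi>" "deep e f L \<psi>"
  shows "deep e f L (\<lambda>h. \<phi> h \<noteq> \<psi> h)"
proof -
  from assms obtain a b c d where
    "\<phi> = (\<lambda>h. (difference G f ^^ L) a h \<noteq> difference G e ((difference G f ^^ (L - 1)) b) h)"
    "\<psi> = (\<lambda>h. (difference G f ^^ L) c h \<noteq> difference G e ((difference G f ^^ (L - 1)) d) h)"
    unfolding deep_def by blast
  then show ?thesis unfolding deep_def
    by (intro exI[of _ "\<lambda>h. a h \<noteq> c h"] exI[of _ "\<lambda>h. b h \<noteq> d h"])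
      (simp only: funpow_difference_add difference_add, auto)
qed

text \<open>Translations commute with differences and are absorbed by the two free
  functions.\<close>

lemma deep_translated:
  assumes "e \<in> carrier G" "f \<in> carrier G" "x \<in> carrier G" "deep e f L \<phi>"
  shows "deep e f L (translated x \<phi>)"
proof -
  from assms(4) obtain a b where
    \<phi>: "\<phi> = (\<lambda>h. (difference G f ^^ L) a h \<noteq> difference G e ((difference G f ^^ (L - 1)) b) h)"
    unfolding deep_def by blast
  have "translated x \<phi> = (\<lambda>h. translated x ((difference G f ^^ L) a) h \<noteq>
      difference G e (translated x ((difference G f ^^ (L - 1)) b)) h)"
    using assms translated_difference[of x e] by (auto simp: \<phi> translated_def fun_eq_iff)
  then show ?thesis
    using translated_funpow_difference[OF assms(3,2), of L a]
      translated_funpow_difference[OF assms(3,2), of "L - 1" b]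
    unfolding deep_def by metis
qed

text \<open>Multiplication by \<open>1 - e\<close> kills the second summand, as
  \<open>(1 - e) ^ 2 = 1 - e ^ 2 = 0\<close>, and turns the first one into a second summand.
  Multiplication by \<open>1 - f\<close> raises the exponents.\<close>

lemma deep_difference_generator:
  assumes e: "e \<in> carrier G" "e \<otimes> e = \<one>" and f: "f \<in> carrier G"
    and x: "x \<in> {e, f}" and "deep e f L \<phi>"
  shows "deep e f (Suc L) (difference G x \<phi>)"
proof -
  from assms(5) obtain a b where
    \<phi>: "\<phi> = (\<lambda>h. (difference G f ^^ L) a h \<noteq> difference G e ((difference G f ^^ (L - 1)) b) h)"
    unfolding deep_def by blast
  from x consider "x = e" | "x = f" by blast
  then show ?thesis
  proof cases
    case 1
    then have "difference G x \<phi> = difference G e ((difference G f ^^ L) a)"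
      unfolding \<phi> by (simp only: difference_add difference_twice e difference_one) simp
    then show ?thesis unfolding deep_def by (intro exI[of _ "\<lambda>h. False"] exI[of _ a]) simp
  next
    case 2
    have "difference G x \<phi> = (\<lambda>h. (difference G f ^^ Suc L) a h \<noteq>
        difference G e ((difference G f ^^ Suc (L - 1)) b) h)"
      unfolding \<phi> 2 by (simp only: difference_add funpow.simps o_apply difference_commute[OF f e(1)])
    \<comment> \<open>For \<open>L = 0\<close> truncated subtraction makes the left exponent 1
      instead of \<open>L\<close>; the surplus difference goes into the function.\<close>
    moreover have "(difference G f ^^ Suc (L - 1)) b = (difference G f ^^ L) (if L = 0 then difference G f b else b)"
      by (cases L) auto
    ultimately show ?thesis unfolding deep_def by (metis diff_Suc_1)
  qed
qed

text \<open>Induction over the generated group by the identities for \<open>1 - x * y\<close> and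
  for inverses.\<close>

lemma deep_difference:
  assumes e: "e \<in> carrier G" "e \<otimes> e = \<one>" and f: "f \<in> carrier G"
    and x: "x \<in> generate G {e, f}" and "deep e f L \<phi>"
  shows "deep e f (Suc L) (difference G x \<phi>)"
  using x assms(5)
proof (induction x arbitrary: \<phi>)
  case one
  then show ?case by (simp add: deep_zero)
next
  case (incl x)
  then show ?case by (rule deep_difference_generator[OF e f])
next
  case (inv x)
  have "x \<in> carrier G" using inv(1) e f by blast
  then show ?case
    using deep_translated[OF e(1) f] deep_difference_generator[OF e f inv] difference_inv by simp
next
  case (eng x y)
  have xy: "x \<in> carrier G" "y \<in> carrier G"
    using eng(1,2) generate_in_carrier[of "{e, f}"] e f by auto
  show ?case
    unfolding difference_mult[OF xy]
    by (intro deep_add eng.IH(1) deep_translated[OF e(1) f xy(1)] eng.IH(2) eng.prems)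
qed

text \<open>Since \<open>(1 - f) ^ (2 ^ a) = 1 - f ^ (2 ^ a) = 0\<close>, it suffices that both
  exponents of \<open>1 - f\<close> reach \<open>2 ^ a\<close>. The smaller one is
  \<open>length xs - 1\<close>, whence the strict inequality.\<close>

lemma differences_vanish:
  assumes e: "e \<in> carrier G" "e \<otimes> e = \<one>" and f: "f \<in> carrier G" "f [^] (2 ^ a :: nat) = \<one>"
    and gen: "generate G {e, f} = carrier G"
    and xs: "set xs \<subseteq> carrier G" "2 ^ a < length xs"
  shows "differences G xs \<phi> = (\<lambda>h. False)"
proof -
  have "deep e f (length xs) (differences G xs \<phi>)"
    using xs(1) by (induction xs) (auto simp: deep_0 gen intro: deep_difference[OF e f(1)])
  then obtain \<psi>1 \<psi>2 where \<psi>: "differences G xs \<phi> = (\<lambda>h. (difference G f ^^ length xs) \<psi>1 h \<noteq>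
      difference G e ((difference G f ^^ (length xs - 1)) \<psi>2) h)" unfolding deep_def by blast
  have "(difference G f ^^ (m + 2 ^ a)) \<psi> = (\<lambda>h. False)" for m \<psi>
    using funpow_difference_two_power[OF f(1), of a \<psi>] f(2) by (simp add: funpow_add)
  then have "(difference G f ^^ m) \<psi> = (\<lambda>h. False)" if "m \<ge> 2 ^ a" for m \<psi>
    using that by (metis le_add_diff_inverse2)
  then show ?thesis using xs(2) unfolding \<psi> by simp
qed

section \<open>Extraction for product-free sequences\<close>

text \<open>The unit of the group algebra, so that \<open>differences G xs at_one\<close> is the
  product of all \<open>1 - x\<close>.\<close>

definition at_one :: "'a \<Rightarrow> bool" where
  "at_one h = (h = \<one>)"

lemma differences_at_one_support:
  assumes "set xs \<subseteq> carrier G" "h \<in> carrier G" "differences G xs at_one h"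
  shows "h \<in> subprods G xs"
  using assms
proof (induction xs arbitrary: h)
  case Nil
  then show ?case by (auto simp: at_one_def split: if_splits)
next
  case (Cons x xs)
  have x: "x \<in> carrier G" "x \<otimes> (inv x \<otimes> h) = h" using Cons.prems by (auto simp flip: m_assoc)
  have "differences G xs at_one h \<or> differences G xs at_one (inv x \<otimes> h)"
    using Cons.prems by (auto simp: difference_def)
  then have "h \<in> subprods G xs \<or> inv x \<otimes> h \<in> subprods G xs" using Cons x by auto
  then show ?case using x(2) by (metis UnCI imageI subprods.simps(2))
qed

text \<open>In the expanded product only the empty subsequence contributes to the coefficient at
  \<one>.\<close>

lemma differences_at_one_product_free:
  assumes "set xs \<subseteq> carrier G" "product_free G xs"
  shows "differences G xs at_one \<one>"
  using assms
proof (induction xs)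
  case (Cons x xs)
  then have "\<not> differences G xs at_one (inv x)"
    using differences_at_one_support[of xs "inv x"] by auto
  then show ?case using Cons by (simp add: difference_def)
qed (simp add: at_one_def)

lemma Nil_in_subseqs: "[] \<in> set (subseqs xs)"
  by (induction xs) (auto simp: Let_def)

lemma foldr_mult_closed: "set xs \<subseteq> carrier G \<Longrightarrow> foldr (\<otimes>) xs \<one> \<in> carrier G"
  by (induction xs) auto

text \<open>Translation by \<open>r\<close> is the identity plus the difference by \<open>r\<close>.
  Translation by the product of \<open>rs\<close> thus expands into a sum of differences over all
  subsequences, of which only the empty one can be nonzero at \<one>.\<close>

lemma differences_stuck:
  assumes "set rs \<subseteq> carrier G"
    and "\<And>qs. qs \<in> set (subseqs rs) \<Longrightarrow> qs \<noteq> [] \<Longrightarrow> \<not> differences G qs \<phi> \<one>"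
  shows "\<phi> (inv (foldr (\<otimes>) rs \<one>)) = \<phi> \<one>"
  using assms
proof (induction rs arbitrary: \<phi>)
  case (Cons r rs)
  have r: "r \<in> carrier G" "foldr (\<otimes>) rs \<one> \<in> carrier G"
    using Cons.prems(1) by (auto simp: foldr_mult_closed)
  have step: "\<not> differences G qs (difference G r \<phi>) \<one>" if "qs \<in> set (subseqs rs)" for qs
  proof -
    have "set qs \<subseteq> carrier G" using that Cons.prems(1) subseqs_powset[of rs] by auto
    then have "differences G qs (difference G r \<phi>) = differences G (r # qs) \<phi>"
      using differences_difference r by simp
    then show ?thesis using Cons.prems(2)[of "r # qs"] that by (auto simp: Let_def)
  qed
  have "difference G r \<phi> (inv (foldr (\<otimes>) rs \<one>)) = difference G r \<phi> \<one>"
    using Cons.prems(1) step by (intro Cons.IH) auto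
  also have "\<dots> = False" using step[OF Nil_in_subseqs] by simp
  finally have "\<phi> (inv r \<otimes> inv (foldr (\<otimes>) rs \<one>)) = \<phi> (inv (foldr (\<otimes>) rs \<one>))"
    using r by (auto simp: difference_def)
  moreover have "\<phi> (inv (foldr (\<otimes>) rs \<one>)) = \<phi> \<one>"
    using Cons.prems by (intro Cons.IH) (auto simp: Let_def)
  ultimately show ?case using r by (simp add: inv_mult)
qed simp

text \<open>Apply differences as long as the coefficient at \<one> stays nonzero; this uses up
  \<open>bs\<close>. When no further choice is possible, \<open>differences_stuck\<close> makes the
  coefficient at the inverse of the remaining product nonzero as well.\<close>

lemma differences_extract:
  assumes "finite I" "g \<in> I \<rightarrow> carrier G" "\<phi> \<one>"
  shows "\<exists>bs rs. distinct (bs @ rs) \<and> set (bs @ rs) = I \<and> differences G (map g bs) \<phi> \<one> \<and>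
    differences G (map g bs) \<phi> (inv (finprod G g (set rs)))"
  using assms
proof (induction "card I" arbitrary: I \<phi> rule: less_induct)
  case less
  obtain rs where rs: "distinct rs" "set rs = I" using finite_distinct_list less.prems(1) by blast
  show ?case
  proof (cases "\<exists>qs. distinct qs \<and> set qs \<subseteq> I \<and> qs \<noteq> [] \<and> differences G (map g qs) \<phi> \<one>")
    case True
    then obtain qs where qs: "distinct qs" "set qs \<subseteq> I" "qs \<noteq> []" "differences G (map g qs) \<phi> \<one>" by blast
    then have "hd qs \<in> set qs" by simp
    then have "I - set qs \<subset> I" using qs(2) by auto
    then have "card (I - set qs) < card I" using less.prems(1) psubset_card_mono by blast
    moreover have "finite (I - set qs)" "g \<in> I - set qs \<rightarrow> carrier G" using less.prems by auto
    ultimately obtain bs ts where "distinct (bs @ ts)" "set (bs @ ts) = I - set qs"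
      "differences G (map g bs) (differences G (map g qs) \<phi>) \<one>"
      "differences G (map g bs) (differences G (map g qs) \<phi>) (inv (finprod G g (set ts)))"
      using less.hyps[of "I - set qs" "differences G (map g qs) \<phi>"] qs(4) by blast
    then show ?thesis using qs
      by (intro exI[of _ "bs @ qs"] exI[of _ ts]) (auto simp: differences_append)
  next
    case False
    have "\<phi> (inv (foldr (\<otimes>) (map g rs) \<one>)) = \<phi> \<one>"
    proof (rule differences_stuck)
      show "set (map g rs) \<subseteq> carrier G" using less.prems(2) rs(2) by auto
      fix xs assume xs: "xs \<in> set (subseqs (map g rs))" "xs \<noteq> []"
      have "subseqs (map g ts) = map (map g) (subseqs ts)" for ts
        by (induction ts) (simp_all add: Let_def)
      then have "set (subseqs (map g rs)) = map g ` set (subseqs rs)" by simp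
      then obtain qs where qs: "qs \<in> set (subseqs rs)" "xs = map g qs" using xs(1) by auto
      have "distinct qs" using subseqs_distinctD[OF qs(1) rs(1)] .
      moreover have "set qs \<subseteq> I" using qs(1) rs(2) subseqs_powset[of rs] by auto
      moreover have "qs \<noteq> []" using qs(2) xs(2) by blast
      ultimately show "\<not> differences G xs \<phi> \<one>" using False unfolding qs(2) by blast
    qed
    moreover have "foldr (\<otimes>) (map g ts) \<one> = finprod G g (set ts)"
      if "distinct ts" "g \<in> set ts \<rightarrow> carrier G" for ts
      using that by (induction ts) (simp_all add: Pi_iff)
    then have "foldr (\<otimes>) (map g rs) \<one> = finprod G g (set rs)" using rs less.prems(2) by blast
    ultimately show ?thesis using rs less.prems(3) by (intro exI[of _ "[]"] exI[of _ rs]) auto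
  qed
qed

lemma subprods_append_extract:
  assumes "distinct bs" "g \<in> set bs \<rightarrow> carrier G" "set xs \<subseteq> carrier G" "a \<in> subprods G (map g bs @ xs)"
  shows "\<exists>B\<subseteq>set bs. inv (finprod G g B) \<otimes> a \<in> subprods G xs"
  using assms
proof (induction bs arbitrary: a)
  case Nil
  then have "a \<in> carrier G" using subprods_carrier by auto
  then show ?case using Nil by simp
next
  case (Cons b bs)
  have b: "g b \<in> carrier G" "g \<in> set bs \<rightarrow> carrier G" "b \<notin> set bs" using Cons.prems by auto
  have sub: "subprods G (map g bs @ xs) \<subseteq> carrier G" using b Cons.prems by (intro subprods_carrier) auto
  from Cons.prems(4) consider "a \<in> subprods G (map g bs @ xs)"
    | a' where "a' \<in> subprods G (map g bs @ xs)" "a = g b \<otimes> a'" by auto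
  then show ?case
  proof cases
    case 1
    then show ?thesis using Cons.IH[of a] Cons.prems b by auto
  next
    case 2
    then obtain B where B: "B \<subseteq> set bs" "inv (finprod G g B) \<otimes> a' \<in> subprods G xs"
      using Cons.IH[of a'] Cons.prems b by auto
    have fB: "finite B" "g \<in> B \<rightarrow> carrier G" "b \<notin> B" using B(1) b finite_subset[OF B(1)] by auto
    have c: "a' \<in> carrier G" "finprod G g B \<in> carrier G" using 2 sub fB by auto
    have "finprod G g (insert b B) = g b \<otimes> finprod G g B" using fB b by (intro finprod_insert) auto
    then have "inv (finprod G g (insert b B)) \<otimes> a = inv (finprod G g B) \<otimes> (inv (g b) \<otimes> (g b \<otimes> a'))"
      using c b 2(2) by (simp add: inv_mult_group m_assoc)
    also have "inv (g b) \<otimes> (g b \<otimes> a') = a'" using c b by (simp flip: m_assoc)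
    finally show ?thesis using B by (intro exI[of _ "insert b B"]) auto
  qed
qed

text \<open>The nonvanishing product of differences over \<open>bs\<close> and \<open>xs\<close> has
  at most \<open>2 ^ a\<close> factors, so at least \<open>k\<close> marked elements remain in
  \<open>rs\<close>. The inverse of their product lies in its support and hence is a subproduct of
  \<open>bs\<close> and \<open>xs\<close> together; the part from \<open>bs\<close> is moved to the
  marked side.\<close>

lemma product_free_extract:
  assumes e: "e \<in> carrier G" "e \<otimes> e = \<one>" and f: "f \<in> carrier G" "f [^] (2 ^ a :: nat) = \<one>"
    and gen: "generate G {e, f} = carrier G"
    and Y: "finite Y" "g \<in> Y \<rightarrow> carrier G" and xs: "set xs \<subseteq> carrier G" "product_free G xs"
    and len: "2 ^ a + k \<le> length xs + card Y"
  shows "\<exists>Z\<subseteq>Y. k \<le> card Z \<and> inv (finprod G g Z) \<in> subprods G xs"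
proof -
  define \<phi> where "\<phi> = differences G xs at_one"
  have "\<phi> \<one>" unfolding \<phi>_def by (rule differences_at_one_product_free[OF xs])
  then obtain bs rs where br: "distinct (bs @ rs)" "set (bs @ rs) = Y" "differences G (map g bs) \<phi> \<one>"
    "differences G (map g bs) \<phi> (inv (finprod G g (set rs)))"
    using differences_extract[OF Y] by blast
  have g: "g \<in> set bs \<rightarrow> carrier G" "g \<in> set rs \<rightarrow> carrier G" using br(2) Y(2) by auto
  have car: "set (map g bs @ xs) \<subseteq> carrier G" using g(1) xs(1) by auto
  have app: "differences G (map g bs) \<phi> = differences G (map g bs @ xs) at_one"
    by (simp add: \<phi>_def differences_append)
  have "length (map g bs @ xs) \<le> 2 ^ a"
  proof (rule ccontr)
    assume "\<not> ?thesis"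
    then have "differences G (map g bs @ xs) at_one = (\<lambda>h. False)"
      by (intro differences_vanish[OF e f gen car]) simp
    then show False using br(3) app by simp
  qed
  moreover have "card Y = length bs + length rs" using distinct_card[OF br(1)] br(2) by simp
  ultimately have k: "k \<le> length rs" using len by simp
  define r where "r = finprod G g (set rs)"
  have r: "r \<in> carrier G" using g by (simp add: r_def)
  have "inv r \<in> subprods G (map g bs @ xs)"
    using differences_at_one_support[OF car, of "inv r"] br(4) app r by (simp add: r_def)
  moreover have "distinct bs" using br(1) by simp
  ultimately obtain B where B: "B \<subseteq> set bs" "inv (finprod G g B) \<otimes> inv r \<in> subprods G xs"
    using subprods_append_extract[OF _ g(1) xs(1)] by blast
  have fB: "finite B" "g \<in> B \<rightarrow> carrier G" "B \<inter> set rs = {}"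
    using B(1) br(1) g finite_subset[OF B(1)] by auto
  have "finprod G g (B \<union> set rs) = finprod G g B \<otimes> r"
    unfolding r_def using fB g by (intro finprod_Un_disjoint) auto
  then have "inv (finprod G g (B \<union> set rs)) \<in> subprods G xs"
    using B(2) fB r by (simp add: inv_mult)
  moreover have "length rs \<le> card (B \<union> set rs)"
    using distinct_card[of rs] br(1) fB(1) card_mono[of "B \<union> set rs" "set rs"] by simp
  moreover have "B \<union> set rs \<subseteq> Y" using B(1) br(2) by auto
  ultimately show ?thesis using k by (intro exI[of _ "B \<union> set rs"]) auto
qed

end

text \<open>
  This covers the unit groups modulo prime powers and passes to quotients.
\<close>

definition tame :: "('a, 'b) monoid_scheme \<Rightarrow> bool" where
  "tame G \<longleftrightarrow> (\<exists>g \<in> carrier G. generate G {g} = carrier G) \<or>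
    (\<exists>e \<in> carrier G. \<exists>f \<in> carrier G. \<exists>a::nat. e \<otimes>\<^bsub>G\<^esub> e = \<one>\<^bsub>G\<^esub> \<and> f [^]\<^bsub>G\<^esub> (2 ^ a :: nat) = \<one>\<^bsub>G\<^esub> \<and>
      generate G {e, f} = carrier G)"

context comm_group
begin

section \<open>Extraction in tame groups\<close>

lemma subprods_replicate: "g \<in> carrier G \<Longrightarrow> subprods G (replicate m g) \<subseteq> {g [^] i | i. i \<le> m}"
proof (induction m)
  case (Suc m)
  have step: "g \<otimes> g [^] i = g [^] Suc i" for i :: nat
    using Suc.prems by (simp add: m_comm)
  show ?case
  proof
    fix x assume "x \<in> subprods G (replicate (Suc m) g)"
    then consider "x \<in> subprods G (replicate m g)" | y where "y \<in> subprods G (replicate m g)" "x = g \<otimes> y"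
      by auto
    then show "x \<in> {g [^] i | i. i \<le> Suc m}"
    proof cases
      case 1
      then obtain i where i: "i \<le> m" "x = g [^] i" using Suc by blast
      have "i \<le> Suc m" using i(1) by simp
      then show ?thesis using i(2) by blast
    next
      case 2
      then obtain i where i: "i \<le> m" "x = g \<otimes> g [^] i" using Suc by blast
      have "Suc i \<le> Suc m" "x = g [^] Suc i" using i step[of i] by simp_all
      then show ?thesis by blast
    qed
  qed
qed simp

lemma product_free_replicate: "g \<in> carrier G \<Longrightarrow> m < ord g \<Longrightarrow> product_free G (replicate m g)"
proof (induction m)
  case (Suc m)
  have "inv g \<notin> subprods G (replicate m g)"
  proof
    assume "inv g \<in> subprods G (replicate m g)"
    then obtain i where i: "i \<le> m" "inv g = g [^] i" using subprods_replicate Suc.prems by blast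
    have "g [^] i \<otimes> g = \<one>" unfolding i(2)[symmetric] using Suc.prems by simp
    then have "g [^] Suc i = \<one>" by simp
    then have "ord g dvd Suc i" using pow_eq_id Suc.prems by blast
    then have "ord g \<le> Suc i" by (rule dvd_imp_le) simp
    then show False using i(1) Suc.prems by simp
  qed
  then show ?case using Suc by simp
qed simp

text \<open>The group is the union of the subgroup generated by \<open>f\<close> and its translate
  by \<open>e\<close>, so this subgroup has index at most two; it is proper because the group is not
  cyclic.\<close>

lemma order_if_generated_by_involution:
  assumes fin: "finite (carrier G)" and e: "e \<in> carrier G" "e \<otimes> e = \<one>" and f: "f \<in> carrier G"
    and gen: "generate G {e, f} = carrier G" and nc: "\<not> in_cyclic G (carrier G)"
  shows "order G = 2 * ord f"
proof -
  define F where "F = generate G {f}"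
  have F: "subgroup F G" unfolding F_def by (rule generate_is_subgroup) (use f in simp)
  have F2: "F \<subseteq> carrier G" by (rule subgroup.subset[OF F])
  have cF: "card F = ord f" unfolding F_def by (rule generate_pow_card[OF f, symmetric])
  define C where "C = F \<union> (\<lambda>y. e \<otimes> y) ` F"
  have C: "C \<subseteq> carrier G" "\<one> \<in> C" using F2 e(1) subgroup.one_closed[OF F] by (auto simp: C_def)
  have fF: "(\<lambda>y. f \<otimes> y) ` F = F"
  proof (rule translate_subset_eq[OF finite_subset[OF F2 fin] F2 f])
    have "f \<in> generate G {f}" by (intro generate.incl) simp
    then show "(\<lambda>y. f \<otimes> y) ` F \<subseteq> F" unfolding F_def by (intro image_subsetI generate.eng)
  qed
  have "(\<lambda>y. f \<otimes> y) ` C = C"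
  proof -
    have "(\<lambda>y. f \<otimes> y) ` (\<lambda>y. e \<otimes> y) ` F = (\<lambda>y. e \<otimes> y) ` (\<lambda>y. f \<otimes> y) ` F"
      by (simp only: translate_translate[OF f e(1) F2] translate_translate[OF e(1) f F2] m_comm[OF e(1) f])
    then show ?thesis by (simp only: C_def image_Un fF)
  qed
  moreover have "(\<lambda>y. e \<otimes> y) ` C = C"
  proof -
    have "(\<lambda>y. e \<otimes> y) ` C = (\<lambda>y. e \<otimes> y) ` F \<union> (\<lambda>y. e \<otimes> y) ` (\<lambda>y. e \<otimes> y) ` F"
      by (simp only: C_def image_Un)
    also have "(\<lambda>y. e \<otimes> y) ` (\<lambda>y. e \<otimes> y) ` F = F"
      by (simp only: translate_translate[OF e(1) e(1) F2] e(2) translate_one[OF F2])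
    finally show ?thesis by (simp only: C_def Un_commute)
  qed
  ultimately have "(\<lambda>y. s \<otimes> y) ` C = C" if "s \<in> {e, f}" for s using that by blast
  note eC = this
  have stab: "(\<lambda>y. g \<otimes> y) ` C = C" if "g \<in> carrier G" for g
    by (rule translate_generate[OF _ C(1), of "{e, f}"]) (use e f gen that eC in simp_all)
  have "carrier G \<subseteq> C"
  proof
    fix g assume g: "g \<in> carrier G"
    then have "g \<otimes> \<one> \<in> C" using stab C(2) by blast
    then show "g \<in> C" using g by simp
  qed
  then have "order G \<le> card C" unfolding order_def using finite_subset[OF C(1) fin] by (intro card_mono)
  also have "\<dots> \<le> card F + card F"
    using card_Un_le[of F "(\<lambda>y. e \<otimes> y) ` F"] card_translate[OF e(1) F2] by (simp add: C_def)
  finally have le: "order G \<le> 2 * ord f" using cF by simp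
  have "F \<noteq> carrier G" using nc f unfolding in_cyclic_def F_def by (metis subset_refl)
  then have "ord f < order G"
    using cF psubset_card_mono[OF fin, of F] F2 unfolding order_def by (simp add: psubset_eq)
  moreover have "ord f dvd order G" using ord_dvd_group_order f by blast
  then obtain m where m: "order G = ord f * m" by (auto simp: dvd_def)
  ultimately have "m \<noteq> 0" "m \<noteq> 1" by auto
  then have "2 \<le> m" by simp
  then have "ord f * 2 \<le> order G" unfolding m by (rule mult_le_mono2)
  then show ?thesis using le by simp
qed

text \<open>In a cyclic group \<open>length hs\<close> growing steps reach everything. Otherwise one
  more may be needed; the extra 1 supplies it unless \<open>xs\<close> is product-free, and then
  \<open>product_free_extract\<close> takes over.\<close>

lemma tame_extract:
  assumes fin: "finite (carrier G)" and "tame G"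
  shows "\<exists>hs. set hs \<subseteq> carrier G \<and> product_free G hs \<and>
    (\<forall>xs Y (g :: 'c \<Rightarrow> 'a) k. set xs \<subseteq> carrier G \<longrightarrow> \<one> \<notin> set xs \<longrightarrow> aperiodic G (subprods G xs) \<longrightarrow>
      finite Y \<longrightarrow> g \<in> Y \<rightarrow> carrier G \<longrightarrow> k \<le> card Y \<longrightarrow>
      length hs + (if product_free G xs then 0 else 1) + k \<le> length xs + card Y \<longrightarrow>
      (\<exists>Z\<subseteq>Y. k \<le> card Z \<and> inv (finprod G g Z) \<in> subprods G xs))"
proof (cases "in_cyclic G (carrier G)")
  case True
  then obtain g0 where g0: "g0 \<in> carrier G" "generate G {g0} = carrier G"
    unfolding in_cyclic_def using generate_incl[of "{_}"] by (meson empty_subsetI insert_subset subset_antisym)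
  then have ord: "ord g0 = order G" using generate_pow_card by (simp add: order_def)
  have pos: "order G > 0" using fin by (simp add: order_gt_0_iff_finite)
  \<comment> \<open>Each growing step adds a product, starting from \<one> alone.\<close>
  have full: "subprods G zs = carrier G"
    if "set zs \<subseteq> carrier G" "growing G zs" "order G - 1 \<le> length zs" for zs
  proof (rule card_seteq[OF fin subprods_carrier[OF that(1)]])
    show "card (carrier G) \<le> card (subprods G zs)"
      using card_growing[OF that(1,2)] that(3) unfolding order_def by simp
  qed
  show ?thesis
  proof (intro exI[of _ "replicate (order G - 1) g0"] conjI allI impI)
    show "set (replicate (order G - 1) g0) \<subseteq> carrier G" using g0(1) by (simp add: set_replicate_conv_if)
    show "product_free G (replicate (order G - 1) g0)"
      by (rule product_free_replicate[OF g0(1)]) (use ord pos in simp)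
    fix xs Y and g :: "'c \<Rightarrow> 'a" and k
    assume xs: "set xs \<subseteq> carrier G" "\<one> \<notin> set xs" "aperiodic G (subprods G xs)"
      and Y: "finite Y" "g \<in> Y \<rightarrow> carrier G" "k \<le> card Y"
      and len: "length (replicate (order G - 1) g0) + (if product_free G xs then 0 else 1) + k \<le> length xs + card Y"
    show "\<exists>Z\<subseteq>Y. k \<le> card Z \<and> inv (finprod G g Z) \<in> subprods G xs"
      by (rule growing_extract[OF Y(1,2) xs(1) growing_if_aperiodic[OF xs] _ Y(3) full]) (use len in simp_all)
  qed
next
  case nc: False
  then have nc': "\<not> (\<exists>g \<in> carrier G. generate G {g} = carrier G)" unfolding in_cyclic_def by (metis subset_refl)
  from assms(2)[unfolded tame_def] have "\<exists>e \<in> carrier G. \<exists>f \<in> carrier G. \<exists>a::nat. e \<otimes> e = \<one> \<and> f [^] (2 ^ a :: nat) = \<one> \<and>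
      generate G {e, f} = carrier G" by (rule disjE) (erule notE[OF nc'], assumption)
  then obtain e f and a :: nat where e: "e \<in> carrier G" "e \<otimes> e = \<one>" and f: "f \<in> carrier G" "f [^] (2 ^ a :: nat) = \<one>"
    and gen: "generate G {e, f} = carrier G" by (elim bexE exE conjE)
  \<comment> \<open>The given exponent is replaced by the exact order of \<open>f\<close>, so that
    the bound from the group algebra equals the length of the product-free list.\<close>
  have "ord f dvd 2 ^ a" using pow_eq_id f by blast
  then obtain b where b: "ord f = 2 ^ b" using divides_primepow_nat two_is_prime_nat by blast
  have fb: "f [^] (2 ^ b :: nat) = \<one>" using pow_ord_eq_1[OF f(1)] b by simp
  have order: "order G = 2 * ord f" by (rule order_if_generated_by_involution[OF fin e f(1) gen nc])
  have e_notin: "e \<notin> generate G {f}"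
  proof
    assume "e \<in> generate G {f}"
    then have "generate G {e, f} \<subseteq> generate G {f}"
      using f(1) generate.incl[of f "{f}" G] by (intro generate_subgroup_incl generate_is_subgroup) auto
    then show False using nc gen f(1) unfolding in_cyclic_def by blast
  qed
  show ?thesis
  proof (intro exI[of _ "e # replicate (ord f - 1) f"] conjI allI impI)
    show "set (e # replicate (ord f - 1) f) \<subseteq> carrier G"
      using e(1) f(1) by (simp add: set_replicate_conv_if)
    have "inv e = e" using e inv_equality by blast
    moreover have "subprods G (replicate (ord f - 1) f) \<subseteq> generate G {f}"
      by (intro subprods_mem_generate) (auto intro: generate.incl)
    ultimately show "product_free G (e # replicate (ord f - 1) f)"
      using e_notin product_free_replicate[OF f(1), of "ord f - 1"] b by auto
    fix xs Y and g :: "'c \<Rightarrow> 'a" and k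
    assume xs: "set xs \<subseteq> carrier G" "\<one> \<notin> set xs" "aperiodic G (subprods G xs)"
      and Y: "finite Y" "g \<in> Y \<rightarrow> carrier G" "k \<le> card Y"
      and len: "length (e # replicate (ord f - 1) f) + (if product_free G xs then 0 else 1) + k \<le> length xs + card Y"
    have l: "length (e # replicate (ord f - 1) f) = ord f" using b by simp
    show "\<exists>Z\<subseteq>Y. k \<le> card Z \<and> inv (finprod G g Z) \<in> subprods G xs"
    proof (cases "product_free G xs")
      case True
      then show ?thesis
        by (intro product_free_extract[OF e f(1) fb gen Y(1,2) xs(1)]) (use len l b in simp_all)
    next
      case False
      \<comment> \<open>As \<open>order G = 2 * ord f\<close>, the number of steps required by
        \<open>growing_full\<close> is one more than the length of the product-free list.\<close>
      have full: "subprods G zs = carrier G"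
        if "set zs \<subseteq> carrier G" "growing G zs" "ord f + 1 \<le> length zs" for zs
        by (rule growing_full[OF fin nc that(1,2)]) (use that(3) order in simp)
      show ?thesis
        by (rule growing_extract[OF Y(1,2) xs(1) growing_if_aperiodic[OF xs] _ Y(3) full]) (use len l False in simp_all)
    qed
  qed
qed

section \<open>Subproducts of indexed families and of homomorphic images\<close>

lemma subprods_filter_one:
  "set xs \<subseteq> carrier G \<Longrightarrow> subprods G (filter (\<lambda>x. x \<noteq> \<one>) xs) = subprods G xs"
  using translate_one[OF subprods_carrier] by (induction xs) auto

lemma subprods_append_ones:
  assumes "set xs \<subseteq> carrier G" "set ys \<subseteq> {\<one>}"
  shows "subprods G (xs @ ys) = subprods G xs"
proof -
  have "filter (\<lambda>x. x \<noteq> \<one>) (xs @ ys) = filter (\<lambda>x. x \<noteq> \<one>) xs"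
    using assms(2) by (auto simp: filter_empty_conv)
  then show ?thesis using subprods_filter_one[of "xs @ ys"] subprods_filter_one[of xs] assms by auto
qed

text \<open>With \<open>product_free_map\<close>, this passes from lists to index sets, which encode
  subsequences in the definitions of the two constants.\<close>

lemma subprods_map:
  assumes "distinct us" "f \<in> set us \<rightarrow> carrier G"
  shows "subprods G (map f us) = {finprod G f J | J. J \<subseteq> set us}"
  using assms
proof (induction us)
  case (Cons u us)
  have u: "f u \<in> carrier G" "f \<in> set us \<rightarrow> carrier G" "u \<notin> set us" using Cons.prems by auto
  have ins: "finprod G f (insert u J) = f u \<otimes> finprod G f J" if "J \<subseteq> set us" for J
    using that u finite_subset[OF that] by (intro finprod_insert) auto
  have "{finprod G f J | J. J \<subseteq> set (u # us)} = finprod G f ` Pow (insert u (set us))" by auto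
  also have "\<dots> = finprod G f ` Pow (set us) \<union> (\<lambda>J. finprod G f (insert u J)) ` Pow (set us)"
    by (simp add: Pow_insert image_Un image_image)
  also have "(\<lambda>J. finprod G f (insert u J)) ` Pow (set us) = (\<lambda>J. f u \<otimes> finprod G f J) ` Pow (set us)"
    using ins by (intro image_cong) auto
  finally show ?case using Cons u by (auto simp: image_image image_Collect)
qed auto

lemma product_free_map:
  assumes "distinct us" "f \<in> set us \<rightarrow> carrier G"
  shows "product_free G (map f us) \<longleftrightarrow> (\<forall>J. J \<subseteq> set us \<longrightarrow> J \<noteq> {} \<longrightarrow> finprod G f J \<noteq> \<one>)"
  using assms
proof (induction us)
  case (Cons u us)
  have u: "f u \<in> carrier G" "f \<in> set us \<rightarrow> carrier G" "u \<notin> set us" "distinct us" using Cons.prems by auto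
  have ins: "finprod G f (insert u J) = \<one> \<longleftrightarrow> inv (f u) = finprod G f J" if "J \<subseteq> set us" for J
  proof -
    have J: "finite J" "f \<in> J \<rightarrow> carrier G" "u \<notin> J" using that u finite_subset[OF that] by auto
    then have "finprod G f (insert u J) = f u \<otimes> finprod G f J" using u by (intro finprod_insert) auto
    moreover have "f u \<otimes> finprod G f J = \<one> \<longleftrightarrow> inv (f u) = finprod G f J"
      using u(1) J by (metis finprod_closed inv_equality m_comm r_inv)
    ultimately show ?thesis by simp
  qed
  have mem: "inv (f u) \<notin> subprods G (map f us) \<longleftrightarrow> (\<forall>J. J \<subseteq> set us \<longrightarrow> finprod G f (insert u J) \<noteq> \<one>)"
    unfolding subprods_map[OF u(4,2)] using ins by blast
  have "product_free G (map f (u # us)) \<longleftrightarrow>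
      (\<forall>J. J \<subseteq> set us \<longrightarrow> J \<noteq> {} \<longrightarrow> finprod G f J \<noteq> \<one>) \<and> (\<forall>J. J \<subseteq> set us \<longrightarrow> finprod G f (insert u J) \<noteq> \<one>)"
    using Cons.IH[OF u(4,2)] mem by simp
  also have "\<dots> \<longleftrightarrow> (\<forall>J. J \<subseteq> insert u (set us) \<longrightarrow> J \<noteq> {} \<longrightarrow> finprod G f J \<noteq> \<one>)" (is "?l \<longleftrightarrow> ?r")
  proof
    assume l: ?l
    show ?r
    proof (intro allI impI)
      fix J assume J: "J \<subseteq> insert u (set us)" "J \<noteq> {}"
      show "finprod G f J \<noteq> \<one>"
      proof (cases "u \<in> J")
        case True
        then have J': "insert u (J - {u}) = J" by (rule insert_Diff)
        have "J - {u} \<subseteq> set us" using J(1) by blast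
        then have "finprod G f (insert u (J - {u})) \<noteq> \<one>" using l by blast
        then show ?thesis unfolding J' .
      next
        case False
        then have "J \<subseteq> set us" using J(1) by blast
        then show ?thesis using l J(2) by blast
      qed
    qed
  next
    assume r: ?r
    show ?l
    proof (intro conjI allI impI)
      fix J assume "J \<subseteq> set us"
      then have "insert u J \<subseteq> insert u (set us)" "insert u J \<noteq> {}" by blast+
      then show "finprod G f (insert u J) \<noteq> \<one>" using r by blast
    qed (use r in blast)
  qed
  finally show ?case by simp
qed simp

end

lemma subprods_hom:
  assumes "h \<in> hom G H" "comm_group G" "comm_group H" "set xs \<subseteq> carrier G"
  shows "subprods H (map h xs) = h ` subprods G xs"
proof -
  interpret G: comm_group G by fact
  interpret H: comm_group H by fact
  have "h \<one>\<^bsub>G\<^esub> = \<one>\<^bsub>H\<^esub>" using hom_one[OF assms(1)] G.group_axioms H.group_axioms by blast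
  then show ?thesis using assms(4)
  proof (induction xs)
    case (Cons x xs)
    have "h (x \<otimes>\<^bsub>G\<^esub> y) = h x \<otimes>\<^bsub>H\<^esub> h y" if "y \<in> subprods G xs" for y
      using hom_mult[OF assms(1)] that G.subprods_carrier[of xs] Cons.prems by auto
    then have "h ` (\<lambda>y. x \<otimes>\<^bsub>G\<^esub> y) ` subprods G xs = (\<lambda>y. h x \<otimes>\<^bsub>H\<^esub> y) ` h ` subprods G xs"
      unfolding image_image by (intro image_cong) auto
    then show ?case using Cons by (simp add: image_Un)
  qed simp
qed

lemma hom_finprod:
  assumes "h \<in> hom G H" "comm_group G" "comm_group H" "f \<in> I \<rightarrow> carrier G" "finite I"
  shows "h (finprod G f I) = finprod H (h \<circ> f) I"
proof -
  interpret G: comm_group G by fact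
  interpret H: comm_group H by fact
  show ?thesis using assms(5,4)
  proof (induction I)
    case empty
    then show ?case using hom_one[OF assms(1)] G.group_axioms H.group_axioms by simp
  next
    case (insert i I)
    then have "h \<circ> f \<in> insert i I \<rightarrow> carrier H" using assms(1) by (auto simp: hom_def)
    then show ?case using insert hom_mult[OF assms(1)] by (simp add: Pi_iff)
  qed
qed

text \<open>Images of generators generate, and the two relations are preserved.\<close>

lemma tame_image:
  assumes "h \<in> hom G H" "comm_group G" "comm_group H" "h ` carrier G = carrier H" "tame G"
  shows "tame H"
proof -
  interpret G: comm_group G by fact
  interpret H: comm_group H by fact
  interpret group_hom G H h
    using assms(1) by (simp add: group_hom_def group_hom_axioms_def)
  from assms(5)[unfolded tame_def] show ?thesis
  proof (elim disjE)
    assume "\<exists>g\<in>carrier G. generate G {g} = carrier G"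
    then obtain g where g: "g \<in> carrier G" "generate G {g} = carrier G" by blast
    then have "generate H {h g} = carrier H" using generate_img[of "{g}"] assms(4) by simp
    then show ?thesis using g hom_closed unfolding tame_def by blast
  next
    assume "\<exists>e\<in>carrier G. \<exists>f\<in>carrier G. \<exists>a::nat. e \<otimes>\<^bsub>G\<^esub> e = \<one>\<^bsub>G\<^esub> \<and>
      f [^]\<^bsub>G\<^esub> (2 ^ a :: nat) = \<one>\<^bsub>G\<^esub> \<and> generate G {e, f} = carrier G"
    then obtain e f and a :: nat where ef: "e \<in> carrier G" "f \<in> carrier G" "e \<otimes>\<^bsub>G\<^esub> e = \<one>\<^bsub>G\<^esub>"
      "f [^]\<^bsub>G\<^esub> (2 ^ a :: nat) = \<one>\<^bsub>G\<^esub>" "generate G {e, f} = carrier G" by blast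
    have "generate H {h e, h f} = carrier H" using generate_img[of "{e, f}"] ef assms(4) by simp
    moreover have "h e \<otimes>\<^bsub>H\<^esub> h e = \<one>\<^bsub>H\<^esub>" using ef hom_mult[of e e] by simp
    moreover have "h f [^]\<^bsub>H\<^esub> (2 ^ a :: nat) = \<one>\<^bsub>H\<^esub>" using ef hom_nat_pow[of f "2 ^ a"] by simp
    ultimately show ?thesis using ef(1,2) hom_closed unfolding tame_def by blast
  qed
qed

context comm_group
begin

section \<open>Reduction to the quotient by the stabilizer\<close>

text \<open>Take \<open>K\<close> as the stabilizer of \<open>A\<close>. Then \<open>A\<close> is a
  union of cosets of \<open>K\<close>, so membership in \<open>A\<close> can be tested in the
  quotient, and a coset that fixes the image of \<open>A\<close> comes from an element fixing
  \<open>A\<close>, hence from \<open>K\<close>.\<close>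

lemma aperiodic_quotient:
  assumes A: "finite A" "A \<subseteq> carrier G" "A \<noteq> {}"
  obtains K where "subgroup K G" "aperiodic (G Mod K) ((\<lambda>x. K #> x) ` A)"
    "\<And>x. x \<in> carrier G \<Longrightarrow> K #> x \<in> (\<lambda>x. K #> x) ` A \<Longrightarrow> x \<in> A"
proof -
  define K where "K = {v \<in> carrier G. (\<lambda>y. v \<otimes> y) ` A = A}"
  have K: "subgroup K G"
  proof
    show "K \<subseteq> carrier G" by (auto simp: K_def)
    show "\<one> \<in> K" using translate_one[OF A(2)] by (simp add: K_def)
    show "x \<otimes> y \<in> K" if "x \<in> K" "y \<in> K" for x y
      using that translate_translate[of x y A] A(2) by (simp add: K_def)
    show "inv x \<in> K" if "x \<in> K" for x
      using that translate_inv[OF A(2), of x] by (simp add: K_def)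
  qed
  have sat: "x \<in> A" if "x \<in> carrier G" "K #> x \<in> (\<lambda>x. K #> x) ` A" for x
  proof -
    from that(2) obtain a where a: "a \<in> A" "K #> x = K #> a" by auto
    have "x \<in> K #> a" using rcos_self[OF that(1) K] a(2) by simp
    then obtain v where "v \<in> K" "x = v \<otimes> a" by (auto simp: r_coset_def)
    then show ?thesis using a(1) by (auto simp: K_def)
  qed
  have "K \<lhd> G" by (rule subgroup_imp_normal[OF K])
  then interpret N: normal K G .
  have ap: "aperiodic (G Mod K) ((\<lambda>x. K #> x) ` A)"
    unfolding aperiodic_def
  proof (intro ballI impI)
    fix V assume V: "V \<in> carrier (G Mod K)"
      and st: "(\<lambda>y. V \<otimes>\<^bsub>G Mod K\<^esub> y) ` (\<lambda>x. K #> x) ` A = (\<lambda>x. K #> x) ` A"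
    from V obtain v where v: "v \<in> carrier G" "V = K #> v" by (auto simp: FactGroup_def RCOSETS_def)
    have "(\<lambda>y. v \<otimes> y) ` A \<subseteq> A"
    proof
      fix z assume "z \<in> (\<lambda>y. v \<otimes> y) ` A"
      then obtain a where a: "a \<in> A" "z = v \<otimes> a" by blast
      then have ac: "a \<in> carrier G" using A(2) by blast
      have "K #> z = V \<otimes>\<^bsub>G Mod K\<^esub> (K #> a)"
        using hom_mult[OF N.r_coset_hom_Mod v(1) ac] a(2) v(2) by simp
      also have "\<dots> \<in> (\<lambda>y. V \<otimes>\<^bsub>G Mod K\<^esub> y) ` (\<lambda>x. K #> x) ` A" using a(1) by (intro imageI)
      finally have "K #> z \<in> (\<lambda>x. K #> x) ` A" unfolding st .
      moreover have "z \<in> carrier G" using a(2) v(1) ac by simp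
      ultimately show "z \<in> A" by (intro sat)
    qed
    then have "(\<lambda>y. v \<otimes> y) ` A = A" by (rule translate_subset_eq[OF A(1,2) v(1)])
    then have "v \<in> K" unfolding K_def using v(1) by (intro CollectI conjI)
    then have "V = K" using coset_join2[OF v(1) K] v(2) by simp
    then show "V = \<one>\<^bsub>G Mod K\<^esub>" by (simp add: FactGroup_def)
  qed
  show thesis by (rule that[OF K ap sat])
qed

end

text \<open>A product-one subsequence meeting \<open>ws\<close> would map to one of
  \<open>map h ws\<close>, because \<open>base\<close> contributes only ones.\<close>

lemma product_free_lift:
  assumes W: "comm_group W" and H: "comm_group H" and h: "h \<in> hom W H"
    and ws: "set ws \<subseteq> carrier W" "product_free H (map h ws)"
    and base: "set base \<subseteq> carrier W" "product_free W base" "h ` set base \<subseteq> {\<one>\<^bsub>H\<^esub>}"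
  shows "product_free W (ws @ base)"
  using ws
proof (induction ws)
  case Nil
  then show ?case using base(2) by simp
next
  case (Cons w ws)
  interpret W: comm_group W by fact
  interpret H: comm_group H by fact
  interpret group_hom W H h using h by (simp add: group_hom_def group_hom_axioms_def)
  have w: "w \<in> carrier W" "set ws \<subseteq> carrier W" using Cons.prems by auto
  have hc: "set (map h ws) \<subseteq> carrier H" using w(2) h by (auto simp: hom_def)
  have "inv\<^bsub>W\<^esub> w \<notin> subprods W (ws @ base)"
  proof
    assume "inv\<^bsub>W\<^esub> w \<in> subprods W (ws @ base)"
    then have "h (inv\<^bsub>W\<^esub> w) \<in> h ` subprods W (ws @ base)" by (rule imageI)
    also have "\<dots> = subprods H (map h (ws @ base))"
      by (rule subprods_hom[OF h W H, symmetric]) (use w(2) base(1) in simp)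
    also have "\<dots> = subprods H (map h ws)"
      unfolding map_append by (rule H.subprods_append_ones[OF hc]) (use base(3) in simp)
    finally have "inv\<^bsub>H\<^esub> (h w) \<in> subprods H (map h ws)" using w(1) by simp
    then show False using Cons.prems(2) by simp
  qed
  moreover have "product_free H (map h ws)" using Cons.prems(2) by simp
  then have "product_free W (ws @ base)" by (rule Cons.IH[OF w(2)])
  ultimately show ?case by simp
qed

text \<open>
  Marked elements \<open>g i\<close> count only through their image in the quotient \<open>G\<close> of \<open>W\<close>. The stabilizer
  \<open>K\<close> of the set of subproducts of the unmarked elements splits the problem: the unmarked elements
  over \<open>K\<close>, together with lifts of a long product-free sequence of \<open>G Mod K\<close>, are product-free
  in \<open>W\<close>, and the other ones have an aperiodic set of subproducts in \<open>G Mod K\<close>.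
\<close>

lemma marked_extract:
  fixes f :: "'i \<Rightarrow> 'a" and g :: "'i \<Rightarrow> 'b"
  assumes W: "comm_group W" and G: "comm_group G" "finite (carrier G)" "tame G"
    and h: "h \<in> hom W G" "h ` carrier W = carrier G"
    and U: "finite U" "f \<in> U \<rightarrow> carrier W" and X: "finite X" "g \<in> X \<rightarrow> carrier G"
    and free: "\<And>J. J \<subseteq> U \<Longrightarrow> J \<noteq> {} \<Longrightarrow> finprod W f J \<noteq> \<one>\<^bsub>W\<^esub>"
    and bound: "\<And>ws. set ws \<subseteq> carrier W \<Longrightarrow> product_free W ws \<Longrightarrow> length ws < D"
    and card: "D + k \<le> card U + card X + 1" "k \<le> card X"
  shows "\<exists>J\<subseteq>U. \<exists>Z\<subseteq>X. k \<le> card Z \<and> h (finprod W f J) \<otimes>\<^bsub>G\<^esub> finprod G g Z = \<one>\<^bsub>G\<^esub>"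
proof -
  interpret W: comm_group W by fact
  interpret G: comm_group G by fact
  obtain us where us: "distinct us" "set us = U" using finite_distinct_list[OF U(1)] by blast
  have hf: "h \<circ> f \<in> U \<rightarrow> carrier G" using h(1) U(2) by (auto simp: hom_def)
  define A where "A = subprods G (map (h \<circ> f) us)"
  have A: "finite A" "A \<subseteq> carrier G" "A \<noteq> {}"
  proof -
    show "finite A" by (simp add: A_def)
    show "A \<subseteq> carrier G" unfolding A_def by (rule G.subprods_carrier) (use hf us(2) in auto)
    show "A \<noteq> {}" using G.one_in_subprods unfolding A_def by blast
  qed
  obtain K where K: "subgroup K G" and ap: "aperiodic (G Mod K) ((\<lambda>x. K #>\<^bsub>G\<^esub> x) ` A)"
    and sat: "\<And>x. x \<in> carrier G \<Longrightarrow> K #>\<^bsub>G\<^esub> x \<in> (\<lambda>x. K #>\<^bsub>G\<^esub> x) ` A \<Longrightarrow> x \<in> A"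
    using G.aperiodic_quotient[OF A] by metis
  define H where "H = G Mod K"
  define r where "r = (\<lambda>x. K #>\<^bsub>G\<^esub> x)"
  have H: "comm_group H" unfolding H_def by (rule G.abelian_FactGroup[OF K])
  interpret H: comm_group H by fact
  have "K \<lhd> G" by (rule G.subgroup_imp_normal[OF K])
  then have r: "r \<in> hom G H" unfolding r_def H_def by (rule normal.r_coset_hom_Mod)
  have r_surj: "r ` carrier G = carrier H" by (auto simp: r_def H_def FactGroup_def RCOSETS_def)
  have H_fin: "finite (carrier H)" unfolding r_surj[symmetric] using G(2) by simp
  have H_tame: "tame H" by (rule tame_image[OF r G(1) H r_surj G(3)])
  define c where "c = r \<circ> h"
  have c: "c \<in> hom W H" unfolding c_def by (rule Group.hom_compose[OF h(1) r])
  have c_surj: "c ` carrier W = carrier H" unfolding c_def image_comp[symmetric] h(2) r_surj ..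
  obtain hs where hs: "set hs \<subseteq> carrier H" "product_free H hs"
    and ext: "\<And>xs Y (g :: 'i \<Rightarrow> 'b set) k. set xs \<subseteq> carrier H \<Longrightarrow> \<one>\<^bsub>H\<^esub> \<notin> set xs \<Longrightarrow>
      aperiodic H (subprods H xs) \<Longrightarrow> finite Y \<Longrightarrow> g \<in> Y \<rightarrow> carrier H \<Longrightarrow> k \<le> card Y \<Longrightarrow>
      length hs + (if product_free H xs then 0 else 1) + k \<le> length xs + card Y \<Longrightarrow>
      \<exists>Z\<subseteq>Y. k \<le> card Z \<and> inv\<^bsub>H\<^esub> (finprod H g Z) \<in> subprods H xs"
    using H.tame_extract[OF H_fin H_tame, where 'c = 'i] by auto
  define us0 where "us0 = filter (\<lambda>u. c (f u) = \<one>\<^bsub>H\<^esub>) us"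
  define us1 where "us1 = filter (\<lambda>u. c (f u) \<noteq> \<one>\<^bsub>H\<^esub>) us"
  define S where "S = map (c \<circ> f) us1"
  have us01: "distinct us0" "distinct us1" "set us0 \<subseteq> U" "set us1 \<subseteq> U" "set us0 \<inter> set us1 = {}"
    using us by (auto simp: us0_def us1_def)
  have len: "length us0 + length us1 = card U"
    using sum_length_filter_compl[of "\<lambda>u. c (f u) = \<one>\<^bsub>H\<^esub>" us] distinct_card[OF us(1)] us(2)
    by (simp add: us0_def us1_def)
  have cf: "c \<circ> f \<in> U \<rightarrow> carrier H" using c U(2) by (auto simp: hom_def)
  have S1: "set S \<subseteq> carrier H" using cf us01(4) by (auto simp: S_def)
  have S2: "\<one>\<^bsub>H\<^esub> \<notin> set S" by (auto simp: S_def us1_def)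
  \<comment> \<open>Dropping entries equal to one does not change the subproducts, so those of
    \<open>S\<close> form the image of \<open>A\<close>, which is aperiodic.\<close>
  have S_sub: "subprods H S = r ` A"
  proof -
    have "S = filter (\<lambda>x. x \<noteq> \<one>\<^bsub>H\<^esub>) (map (c \<circ> f) us)"
      by (simp add: S_def us1_def filter_map o_def)
    then have "subprods H S = subprods H (map (c \<circ> f) us)"
      by (simp only:) (rule H.subprods_filter_one, use cf us(2) in auto)
    also have "map (c \<circ> f) us = map r (map (h \<circ> f) us)" by (simp add: c_def)
    also have "subprods H (map r (map (h \<circ> f) us)) = r ` A"
      unfolding A_def by (rule subprods_hom[OF r G(1) H]) (use hf us(2) in auto)
    finally show ?thesis .
  qed
  have S3: "aperiodic H (subprods H S)" unfolding S_sub using ap unfolding H_def r_def .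
  define z :: nat where "z = (if product_free H S then 0 else 1)"
  have f0: "f \<in> set us0 \<rightarrow> carrier W" "f \<in> set us1 \<rightarrow> carrier W" using U(2) us01 by auto
  have free0: "product_free W (map f us0)"
    unfolding W.product_free_map[OF us01(1) f0(1)] using free us01(3) by blast
  \<comment> \<open>If the units not over \<open>K\<close> are not product-free modulo
    \<open>K\<close>, some of them multiply to an element \<open>m\<close> over \<open>K\<close>.
    Adding it to the units over \<open>K\<close> gives the extra element that pays for the lost
    step.\<close>
  obtain base where base: "set base \<subseteq> carrier W" "product_free W base" "c ` set base \<subseteq> {\<one>\<^bsub>H\<^esub>}"
    "length base = z + length us0"
  proof (cases "product_free H S")
    case True
    show thesis
      by (rule that[of "map f us0"]) (use True f0(1) free0 in \<open>auto simp: z_def us0_def\<close>)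
  next
    case False
    have cf1: "c \<circ> f \<in> set us1 \<rightarrow> carrier H" using cf us01(4) by auto
    obtain J where J: "J \<subseteq> set us1" "J \<noteq> {}" "finprod H (c \<circ> f) J = \<one>\<^bsub>H\<^esub>"
      using False unfolding S_def H.product_free_map[OF us01(2) cf1] by blast
    have fJ: "finite J" "f \<in> J \<rightarrow> carrier W" using finite_subset[OF J(1)] J(1) f0(2) by auto
    define m where "m = finprod W f J"
    have m: "m \<in> carrier W" using fJ by (simp add: m_def)
    have cm: "c m = \<one>\<^bsub>H\<^esub>" using hom_finprod[OF c W H fJ(2,1)] J(3) by (simp add: m_def)
    \<comment> \<open>Otherwise the units forming \<open>m\<close> together with some units over
      \<open>K\<close> would have product one; their index sets are disjoint.\<close>
    have "inv\<^bsub>W\<^esub> m \<notin> subprods W (map f us0)"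
    proof
      assume "inv\<^bsub>W\<^esub> m \<in> subprods W (map f us0)"
      then obtain J' where J': "J' \<subseteq> set us0" "inv\<^bsub>W\<^esub> m = finprod W f J'"
        unfolding W.subprods_map[OF us01(1) f0(1)] by blast
      have fJ': "finite J'" "f \<in> J' \<rightarrow> carrier W" using finite_subset[OF J'(1)] J'(1) f0(1) by auto
      have "J \<inter> J' = {}" using J(1) J'(1) us01(5) by blast
      then have "finprod W f (J \<union> J') = m \<otimes>\<^bsub>W\<^esub> inv\<^bsub>W\<^esub> m"
        unfolding J'(2) unfolding m_def using fJ fJ' by (intro W.finprod_Un_disjoint)
      then have "finprod W f (J \<union> J') = \<one>\<^bsub>W\<^esub>" using m by simp
      moreover have "J \<union> J' \<subseteq> U" "J \<union> J' \<noteq> {}" using J J'(1) us01(3,4) by blast+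
      ultimately show False using free by blast
    qed
    then have "product_free W (m # map f us0)" using free0 by simp
    then show thesis
      by (intro that[of "m # map f us0"]) (use False f0(1) m cm in \<open>auto simp: z_def us0_def\<close>)
  qed
  define ws where "ws = map (inv_into (carrier W) c) hs"
  have ws: "set ws \<subseteq> carrier W" "map c ws = hs"
  proof -
    show "set ws \<subseteq> carrier W"
      using hs(1) c_surj by (auto simp: ws_def intro!: inv_into_into)
    show "map c ws = hs"
      unfolding ws_def map_map
      by (rule map_idI) (use hs(1) c_surj in \<open>auto simp: f_inv_into_f\<close>)
  qed
  \<comment> \<open>This list is shorter than \<open>D\<close>, which bounds the number of units
    over \<open>K\<close> and leaves enough other elements for \<open>ext\<close>.\<close>
  have "product_free W (ws @ base)"
    by (rule product_free_lift[OF W H c ws(1) _ base(1-3)]) (use ws(2) hs(2) in simp)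
  then have "length (ws @ base) < D" by (intro bound) (use ws(1) base(1) in simp)
  moreover have "length ws = length hs" by (simp add: ws_def)
  ultimately have "length hs + z + length us0 < D" using base(4) by simp
  then have "length hs + z + k \<le> length S + card X" using card(1) len by (simp add: S_def)
  moreover have rg: "r \<circ> g \<in> X \<rightarrow> carrier H" using X(2) r by (auto simp: hom_def)
  ultimately obtain Z where Z: "Z \<subseteq> X" "k \<le> card Z" "inv\<^bsub>H\<^esub> (finprod H (r \<circ> g) Z) \<in> subprods H S"
    using ext[OF S1 S2 S3 X(1) rg card(2)] unfolding z_def by blast
  have fZ: "finite Z" "g \<in> Z \<rightarrow> carrier G" using finite_subset[OF Z(1) X(1)] Z(1) X(2) by auto
  have gZ: "finprod G g Z \<in> carrier G" using fZ by simp
  interpret rh: group_hom G H r using r by (simp add: group_hom_def group_hom_axioms_def)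
  \<comment> \<open>Membership in \<open>A\<close> is decided in the quotient, which brings the
    result back to \<open>G\<close>.\<close>
  have "r (inv\<^bsub>G\<^esub> (finprod G g Z)) \<in> r ` A"
    using Z(3) hom_finprod[OF r G(1) H fZ(2,1)] gZ by (simp add: S_sub)
  then have "inv\<^bsub>G\<^esub> (finprod G g Z) \<in> A" by (intro sat) (use gZ in \<open>simp_all add: r_def\<close>)
  moreover have hfu: "h \<circ> f \<in> set us \<rightarrow> carrier G" using hf us(2) by simp
  ultimately obtain J where J: "J \<subseteq> U" "inv\<^bsub>G\<^esub> (finprod G g Z) = finprod G (h \<circ> f) J"
    unfolding A_def G.subprods_map[OF us(1) hfu] us(2) by blast
  have fJ: "finite J" "f \<in> J \<rightarrow> carrier W" using finite_subset[OF J(1) U(1)] J(1) U(2) by auto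
  have "h (finprod W f J) = inv\<^bsub>G\<^esub> (finprod G g Z)"
    using hom_finprod[OF h(1) W G(1) fJ(2,1)] J(2) by simp
  then have "h (finprod W f J) \<otimes>\<^bsub>G\<^esub> finprod G g Z = \<one>\<^bsub>G\<^esub>" using gZ by simp
  then show ?thesis using J(1) Z(1,2) by blast
qed

section \<open>Residue rings\<close>

context residues
begin

section \<open>Products and unit groups of residue rings\<close>

lemma finprod_residues:
  assumes "f \<in> I \<rightarrow> carrier R" "finite I"
  shows "finprod R f I = (\<Prod>i\<in>I. f i) mod m"
  using assms(2,1)
proof (induction I)
  case empty
  then show ?case using m_gt_one by (simp add: res_one_eq)
next
  case (insert i I)
  then have "finprod R f (insert i I) = f i \<otimes> finprod R f I" by (intro finprod_insert) auto
  then show ?case using insert by (simp add: res_mult_eq mod_simps)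
qed

lemma finprod_residue_units:
  assumes "f \<in> I \<rightarrow> Units R" "finite I"
  shows "finprod (units_of R) f I = (\<Prod>i\<in>I. f i) mod m"
  using assms(2,1)
proof (induction I)
  case empty
  interpret W: comm_group "units_of R" by (rule units_comm_group)
  show ?case using m_gt_one W.finprod_empty[of f] by (simp add: units_of_one res_one_eq)
next
  case (insert i I)
  interpret W: comm_group "units_of R" by (rule units_comm_group)
  have f: "f i \<in> carrier (units_of R)" "f \<in> I \<rightarrow> carrier (units_of R)"
    using insert.prems by (auto simp: units_of_carrier)
  have "finprod (units_of R) f (insert i I) = f i \<otimes>\<^bsub>units_of R\<^esub> finprod (units_of R) f I"
    using insert.hyps f by (intro W.finprod_insert)
  also have "\<dots> = f i * ((\<Prod>i\<in>I. f i) mod m) mod m"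
    using insert.IH insert.prems by (simp add: units_of_mult res_mult_eq)
  finally show ?case using insert.hyps by (simp add: mod_simps)
qed

lemma nat_pow_residue_units: "x \<in> Units R \<Longrightarrow> x [^]\<^bsub>units_of R\<^esub> (i::nat) = x ^ i mod m"
proof (induction i)
  case 0
  interpret W: comm_group "units_of R" by (rule units_comm_group)
  show ?case using m_gt_one W.nat_pow_0[of x] by (simp add: units_of_one res_one_eq)
next
  case (Suc i)
  interpret W: comm_group "units_of R" by (rule units_comm_group)
  show ?case using W.nat_pow_Suc[of x i] Suc by (simp add: units_of_mult res_mult_eq mod_simps mult.commute)
qed

lemma tame_units_if_primroot:
  assumes "residue_primroot (nat m) g"
  shows "tame (units_of R)"
proof -
  interpret W: comm_group "units_of R" by (rule units_comm_group)
  define x where "x = int g mod m"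
  have cop: "coprime (int g) m"
    using assms m_gt_one coprime_int_iff[of "nat m" g] by (auto simp: residue_primroot_def coprime_commute)
  have x: "x \<in> Units R"
    using cop m_gt_one by (simp add: x_def coprime_commute)
  have "carrier (units_of R) \<subseteq> generate (units_of R) {x}"
  proof
    fix u assume "u \<in> carrier (units_of R)"
    then have u: "u \<in> Units R" by (simp add: units_of_carrier)
    then have "nat u \<in> totatives (nat m)" unfolding totatives_eq by (rule imageI)
    also have "totatives (nat m) = (\<lambda>i. g ^ i mod nat m) ` {..<totient (nat m)}"
      using residue_primroot_is_generator[of "nat m" g] assms m_gt_one by (simp add: bij_betw_def)
    finally obtain i where i: "nat u = g ^ i mod nat m" by blast
    have "u = int (nat u)" using u by (simp add: res_units_eq)
    also have "\<dots> = int g ^ i mod m" unfolding i using m_gt_one by (simp add: zmod_int)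
    also have "\<dots> = x ^ i mod m" by (simp add: x_def power_mod)
    also have "\<dots> = x [^]\<^bsub>units_of R\<^esub> i" using x by (simp add: nat_pow_residue_units)
    finally have "u = x [^]\<^bsub>units_of R\<^esub> i" .
    moreover have "x [^]\<^bsub>units_of R\<^esub> j \<in> generate (units_of R) {x}" for j :: nat
    proof (induction j)
      case 0
      then show ?case using generate.one[of "units_of R" "{x}"] by simp
    next
      case (Suc j)
      have "x \<in> generate (units_of R) {x}" by (intro generate.incl) simp
      then show ?case unfolding W.nat_pow_Suc by (rule generate.eng[OF Suc])
    qed
    ultimately show "u \<in> generate (units_of R) {x}" by simp
  qed
  moreover have xc: "x \<in> carrier (units_of R)" using x by (simp add: units_of_carrier)
  ultimately have "generate (units_of R) {x} = carrier (units_of R)"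
    using W.generate_incl[of "{x}"] by (intro subset_antisym) simp_all
  then show ?thesis unfolding tame_def using xc by (intro disjI1 bexI[of _ x])
qed

end

text \<open>The generators are -1, written \<open>m - 1\<close>, and 3. Powers of 3 are 1 or 3
  modulo 8 and their negatives 7 or 5, so the two sets are disjoint; with \<open>2 ^ (l - 2)\<close>
  elements each they exhaust the units.\<close>

lemma tame_units_two_power:
  assumes "l \<ge> 3"
  shows "tame (units_of (residue_ring (2 ^ l)))"
proof -
  define m :: int where "m = 2 ^ l"
  have m8: "8 dvd m" using assms le_imp_power_dvd[of 3 l "2::int"] by (simp add: m_def)
  have m_pos: "m > 0" by (simp add: m_def)
  then have m_ge: "m \<ge> 8" using m8 by (rule zdvd_imp_le[rotated])
  interpret residues m "residue_ring m" using m_ge by unfold_locales simp_all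
  let ?R = "residue_ring m"
  interpret W: comm_group "units_of ?R" by (rule units_comm_group)
  have cop2: "coprime x m \<longleftrightarrow> odd x" for x :: int
    using assms by (simp add: m_def)
  have e: "m - 1 \<in> Units ?R" and f: "3 \<in> Units ?R"
    using m_ge m8 dvd_trans[of 2 8 m] by (auto simp: res_units_eq cop2)
  have ec: "m - 1 \<in> carrier (units_of ?R)" and fc: "3 \<in> carrier (units_of ?R)"
    using e f by (simp_all add: units_of_carrier)
  have ee: "(m - 1) \<otimes>\<^bsub>units_of ?R\<^esub> (m - 1) = \<one>\<^bsub>units_of ?R\<^esub>"
  proof -
    have "(m - 1) * (m - 1) = 1 + m * (m - 2)" by (simp add: algebra_simps)
    then have "(m - 1) * (m - 1) mod m = 1" using m_ge by simp
    then show ?thesis by (simp add: units_of_mult units_of_one res_mult_eq res_one_eq)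
  qed
  have ord3: "ord (2 ^ l) (3::nat) = 2 ^ (l - 2)" using ord_twopow_3_5[of l 3] assms by simp
  have ff: "3 [^]\<^bsub>units_of ?R\<^esub> (2 ^ (l - 2) :: nat) = \<one>\<^bsub>units_of ?R\<^esub>"
  proof -
    have "[3 ^ 2 ^ (l - 2) = 1] (mod 2 ^ l :: nat)" using ord[of 3 "2 ^ l"] ord3 by simp
    then have "[int (3 ^ 2 ^ (l - 2)) = int 1] (mod int (2 ^ l))" by (simp only: cong_int_iff)
    then have "(3::int) ^ 2 ^ (l - 2) mod m = 1" using m_ge assms by (simp add: cong_def m_def)
    then show ?thesis using f by (simp add: nat_pow_residue_units units_of_one res_one_eq)
  qed
  define F where "F = generate (units_of ?R) {m - 1, 3}"
  have F_sub: "F \<subseteq> carrier (units_of ?R)" unfolding F_def by (rule W.generate_incl) (use ec fc in simp)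
  define P where "P = (\<lambda>i. (3::int) ^ i mod m) ` {..<2 ^ (l - 2)}"
  have P_F: "P \<subseteq> F"
  proof -
    have "3 ^ i mod m \<in> F" for i :: nat
    proof (induction i)
      case 0
      have "1 mod m = \<one>\<^bsub>units_of ?R\<^esub>" using m_ge by (simp add: units_of_one res_one_eq)
      then show ?case unfolding F_def by (simp add: generate.one)
    next
      case (Suc i)
      have "3 \<in> F" unfolding F_def by (intro generate.incl) simp
      then have "3 \<otimes>\<^bsub>units_of ?R\<^esub> (3 ^ i mod m) \<in> F" using Suc unfolding F_def by (rule generate.eng)
      then show ?case by (simp add: units_of_mult res_mult_eq mod_simps)
    qed
    then show ?thesis by (auto simp: P_def)
  qed
  have eP_F: "(\<lambda>y. (m - 1) \<otimes>\<^bsub>units_of ?R\<^esub> y) ` P \<subseteq> F"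
  proof
    fix z assume "z \<in> (\<lambda>y. (m - 1) \<otimes>\<^bsub>units_of ?R\<^esub> y) ` P"
    then obtain y where y: "y \<in> F" "z = (m - 1) \<otimes>\<^bsub>units_of ?R\<^esub> y" using P_F by blast
    have "m - 1 \<in> F" unfolding F_def by (intro generate.incl) simp
    then show "z \<in> F" using y unfolding F_def by (simp add: generate.eng)
  qed
  have mod8: "y mod 8 \<in> {1, 3}" if "y \<in> P" for y
  proof -
    have three: "(3::int) ^ i mod 8 \<in> {1, 3}" for i :: nat
    proof (induction i)
      case (Suc i)
      have "(3::int) ^ Suc i mod 8 = 3 * (3 ^ i mod 8) mod 8" by (simp add: mod_simps)
      then show ?case using Suc by auto
    qed simp
    from that obtain i where "y = 3 ^ i mod m" by (auto simp: P_def)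
    then have "y mod 8 = 3 ^ i mod 8" using m8 by (simp add: mod_mod_cancel)
    then show ?thesis using three[of i] by simp
  qed
  have mod8': "z mod 8 \<in> {5, 7}" if "z \<in> (\<lambda>y. (m - 1) \<otimes>\<^bsub>units_of ?R\<^esub> y) ` P" for z
  proof -
    from that obtain y where y: "y \<in> P" "z = (m - 1) * y mod m" by (auto simp: units_of_mult res_mult_eq)
    have "z mod 8 = (m - 1) * y mod 8" using y(2) m8 by (simp add: mod_mod_cancel)
    also have "\<dots> = ((m - 1) mod 8) * (y mod 8) mod 8" by (simp add: mod_simps)
    also have "(m - 1) mod 8 = 7" using m8 by presburger
    finally show ?thesis using mod8[OF y(1)] by auto
  qed
  have cP: "card P = 2 ^ (l - 2)"
  proof -
    have inj: "inj_on (\<lambda>i. (3::nat) ^ i mod 2 ^ l) {..<2 ^ (l - 2)}"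
      using inj_power_mod[of "2 ^ l" "3::nat"] ord3 by simp
    have conv: "(3::int) ^ i mod m = int (3 ^ i mod 2 ^ l)" for i :: nat by (simp add: m_def zmod_int)
    have "inj_on (\<lambda>i. (3::int) ^ i mod m) {..<2 ^ (l - 2)}"
    proof (rule inj_onI)
      fix i j assume ij: "i \<in> {..<2 ^ (l - 2)}" "j \<in> {..<2 ^ (l - 2)}" "(3::int) ^ i mod m = 3 ^ j mod m"
      have "(3::nat) ^ i mod 2 ^ l = 3 ^ j mod 2 ^ l" using ij(3) unfolding conv by (simp only: of_nat_eq_iff)
      then show "i = j" using inj ij(1,2) by (simp add: inj_on_def)
    qed
    then show ?thesis by (simp add: P_def card_image)
  qed
  have fin: "finite (carrier (units_of ?R))" by (simp add: units_of_carrier)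
  have P_car: "P \<subseteq> carrier (units_of ?R)" using P_F F_sub by blast
  have "P \<inter> (\<lambda>y. (m - 1) \<otimes>\<^bsub>units_of ?R\<^esub> y) ` P = {}"
  proof (rule ccontr)
    assume "\<not> ?thesis"
    then obtain z where "z \<in> P" "z \<in> (\<lambda>y. (m - 1) \<otimes>\<^bsub>units_of ?R\<^esub> y) ` P" by blast
    from mod8[OF this(1)] mod8'[OF this(2)] show False by auto
  qed
  then have "card (P \<union> (\<lambda>y. (m - 1) \<otimes>\<^bsub>units_of ?R\<^esub> y) ` P) = 2 ^ (l - 2) + 2 ^ (l - 2)"
    using W.card_translate[OF ec P_car] finite_subset[OF P_car fin] cP by (subst card_Un_disjoint) auto
  also have "\<dots> = 2 ^ (l - 1)"
  proof -
    have "l - 1 = Suc (l - 2)" using assms by simp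
    then show ?thesis by simp
  qed
  also have "\<dots> = totient (2 ^ l)" using assms by (simp add: totient_prime_power)
  also have "\<dots> = card (carrier (units_of ?R))"
    using totient_eq by (simp add: units_of_carrier m_def nat_power_eq)
  finally have "card (carrier (units_of ?R)) \<le> card F"
    using card_mono[OF finite_subset[OF F_sub fin], of "P \<union> (\<lambda>y. (m - 1) \<otimes>\<^bsub>units_of ?R\<^esub> y) ` P"] P_F eP_F by simp
  then have "F = carrier (units_of ?R)" by (rule card_seteq[OF fin F_sub])
  then have "tame (units_of ?R)" unfolding tame_def F_def
    by (intro disjI2 bexI[OF _ ec] bexI[OF _ fc] exI[of _ "l - 2"] conjI ee ff)
  then show ?thesis by (simp add: m_def)
qed

text \<open>Modulo 2, 4 and odd prime powers there is a primitive root; the higher powers of 2 are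
  covered by \<open>tame_units_two_power\<close>.\<close>

lemma tame_units_prime_power:
  assumes "prime q" "l > 0"
  shows "tame (units_of (residue_ring (int (q ^ l))))"
proof (cases "q = 2 \<and> l \<ge> 3")
  case True
  then show ?thesis using tame_units_two_power by simp
next
  case False
  have q1: "q ^ l > 1" using assms prime_gt_1_nat one_less_power by blast
  interpret residues "int (q ^ l)" "residue_ring (int (q ^ l))"
    by (unfold_locales, use q1 in linarith) simp
  have "q ^ l \<in> cyclic_moduli"
  proof (cases "q = 2")
    case True
    with False assms have "l = 1 \<or> l = 2" by auto
    then show ?thesis using True by (auto simp: cyclic_moduli_def)
  next
    case False
    then have "odd q" using assms(1) primes_dvd_imp_eq two_is_prime_nat by blast
    then show ?thesis using assms by (auto simp: cyclic_moduli_def)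
  qed
  then have "\<exists>g. residue_primroot (q ^ l) g" unfolding residue_primroot_iff_in_cyclic_moduli .
  then obtain g where "residue_primroot (q ^ l) g" by blast
  then show ?thesis using tame_units_if_primroot[of g] by (simp only: nat_int)
qed

section \<open>General facts on the two constants\<close>

lemma erdos_burgess_property_mono:
  assumes "erdos_burgess_property S t" "t \<le> t'"
  shows "erdos_burgess_property S t'"
  unfolding erdos_burgess_property_def
proof
  fix f assume "f \<in> {..<t'} \<rightarrow> carrier S"
  then have "f \<in> {..<t} \<rightarrow> carrier S" using assms(2) by auto
  then obtain I where "I \<subseteq> {..<t}" "I \<noteq> {}" "finprod S f I \<otimes>\<^bsub>S\<^esub> finprod S f I = finprod S f I"
    using assms(1) unfolding erdos_burgess_property_def by blast
  moreover have "{..<t} \<subseteq> {..<t'}" using assms(2) by auto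
  ultimately show "\<exists>I\<subseteq>{..<t'}. I \<noteq> {} \<and> finprod S f I \<otimes>\<^bsub>S\<^esub> finprod S f I = finprod S f I"
    by (meson order_trans)
qed

text \<open>By monotonicity, a failure at \<open>t\<close> rules out all smaller values.\<close>

lemma erdos_burgess_eqI:
  assumes "erdos_burgess_property S (Suc t)" "\<not> erdos_burgess_property S t"
  shows "erdos_burgess S = Suc t"
  unfolding erdos_burgess_def
proof (rule Least_equality)
  show "0 < Suc t \<and> erdos_burgess_property S (Suc t)" using assms(1) by simp
  show "Suc t \<le> u" if "0 < u \<and> erdos_burgess_property S u" for u
    using that assms(2) erdos_burgess_property_mono[of S u t] by (cases "u \<le> t") auto
qed

context comm_group
begin

lemma davenport_attained:
  assumes "finite (carrier G)"
  shows "0 < davenport G \<and> davenport_property G (davenport G)"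
  unfolding davenport_def by (rule LeastI_ex[OF davenport_property_exists[OF assms]])

lemma length_product_free:
  assumes "finite (carrier G)" "set ws \<subseteq> carrier G" "product_free G ws"
  shows "length ws < davenport G"
proof (rule ccontr)
  assume "\<not> ?thesis"
  then have D: "davenport G \<le> length ws" by simp
  have ws: "(!) ws \<in> {..<length ws} \<rightarrow> carrier G" using assms(2) by auto
  then have "(!) ws \<in> {..<davenport G} \<rightarrow> carrier G" using D by auto
  then obtain I where I: "I \<subseteq> {..<davenport G}" "I \<noteq> {}" "finprod G ((!) ws) I = \<one>"
    using conjunct2[OF davenport_attained[OF assms(1)], unfolded davenport_property_def] by blast
  have "product_free G (map ((!) ws) [0..<length ws])" using assms(3) by (simp add: map_nth)
  moreover have "(!) ws \<in> set [0..<length ws] \<rightarrow> carrier G" using ws by auto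
  ultimately have "\<forall>J. J \<subseteq> set [0..<length ws] \<longrightarrow> J \<noteq> {} \<longrightarrow> finprod G ((!) ws) J \<noteq> \<one>"
    using product_free_map[of "[0..<length ws]" "(!) ws"] by simp
  moreover have "I \<subseteq> set [0..<length ws]" using I(1) D by auto
  ultimately show False using I(2,3) by blast
qed

lemma davenport_witness:
  "\<exists>w \<in> {..<davenport G - 1} \<rightarrow> carrier G.
    \<forall>I. I \<subseteq> {..<davenport G - 1} \<longrightarrow> I \<noteq> {} \<longrightarrow> finprod G w I \<noteq> \<one>"
proof -
  have "\<not> davenport_property G (davenport G - 1)"
  proof (cases "davenport G - 1 = 0")
    case True
    \<comment> \<open>Length 0 is excluded from the minimum, but there the property fails for want
      of a nonempty index set.\<close>
    then show ?thesis by (auto simp: davenport_property_def)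
  next
    case False
    then have "davenport G - 1 < (LEAST t. t > 0 \<and> davenport_property G t)"
      unfolding davenport_def by simp
    then have "\<not> (davenport G - 1 > 0 \<and> davenport_property G (davenport G - 1))" by (rule not_less_Least)
    then show ?thesis using False by simp
  qed
  then show ?thesis unfolding davenport_property_def by blast
qed

end

section \<open>Idempotent products modulo two prime powers\<close>

lemma idempotent_modI:
  fixes x :: int
  assumes "coprime a b" "a dvd x" "[x = 1] (mod b)"
  shows "[x * x = x] (mod a * b)"
proof -
  have "b dvd x - 1" using assms(3) by (simp add: cong_iff_dvd_diff)
  then have "a * b dvd x * (x - 1)" using assms(2) by (intro mult_dvd_mono)
  then show ?thesis by (simp add: cong_iff_dvd_diff algebra_simps)
qed

lemma power_dvd_prod_if_card:
  fixes f :: "'i \<Rightarrow> int"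
  assumes "finite Z" "\<And>i. i \<in> Z \<Longrightarrow> p dvd f i" "k \<le> card Z"
  shows "p ^ k dvd (\<Prod>i\<in>Z. f i)"
proof -
  have "p ^ k dvd p ^ card Z" using assms(3) by (rule le_imp_power_dvd)
  also have "p ^ card Z = (\<Prod>i\<in>Z. p)" by simp
  also have "\<dots> dvd (\<Prod>i\<in>Z. f i)" using assms(2) by (intro prod_dvd_prod) 
  finally show ?thesis .
qed

lemma coprime_prime_powers_iff:
  fixes p q :: nat and x :: int
  assumes "prime p" "prime q" "k > 0" "l > 0"
  shows "coprime x (int (p ^ k * q ^ l)) \<longleftrightarrow> \<not> int p dvd x \<and> \<not> int q dvd x"
proof -
  have "coprime x (int r) \<longleftrightarrow> \<not> int r dvd x" if "prime r" for r
    using that prime_imp_coprime[of "int r" x] by (auto simp: coprime_commute not_coprimeI)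
  then show ?thesis using assms by simp
qed

lemma moduli_gt_one:
  fixes p q k l :: nat
  assumes "prime p" "prime q" "k > 0" "l > 0"
  shows "1 < int (q ^ l)" "1 < int (p ^ k * q ^ l)"
proof -
  have "1 < p ^ k" "1 < q ^ l"
    by (rule one_less_power[OF prime_gt_1_nat[OF assms(1)] assms(3)],
        rule one_less_power[OF prime_gt_1_nat[OF assms(2)] assms(4)])
  moreover from this have "1 < p ^ k * q ^ l" by (rule less_1_mult)
  ultimately show "1 < int (q ^ l)" "1 < int (p ^ k * q ^ l)" by (simp_all only: one_of_nat_less_iff)
qed

text \<open>For surjectivity, the Chinese remainder theorem lifts a unit modulo \<open>q ^ l\<close>
  to a number that is 1 modulo \<open>p ^ k\<close>, hence to a unit.\<close>

lemma units_reduction: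
  fixes p q k l :: nat
  assumes pq: "prime p" "prime q" "p \<noteq> q" "k > 0" "l > 0"
  defines "W \<equiv> units_of (residue_ring (int (p ^ k * q ^ l)))"
    and "V \<equiv> units_of (residue_ring (int (q ^ l)))"
  shows "(\<lambda>x. x mod int (q ^ l)) \<in> hom W V" "(\<lambda>x. x mod int (q ^ l)) ` carrier W = carrier V"
proof -
  let ?n = "int (p ^ k * q ^ l)" and ?m = "int (q ^ l)"
  have m1: "?m > 1" and n1: "?n > 1" by (rule moduli_gt_one[OF pq(1,2,4,5)])+
  interpret n: residues ?n "residue_ring ?n" by (unfold_locales, rule n1) simp
  interpret m: residues ?m "residue_ring ?m" by (unfold_locales, rule m1) simp
  have m_n: "?m dvd ?n" by simp
  have units_n: "carrier W = {x. 0 < x \<and> x < ?n \<and> coprime x ?n}"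
    unfolding W_def units_of_carrier by (rule n.res_units_eq)
  have units_m: "carrier V = {x. 0 < x \<and> x < ?m \<and> coprime x ?m}"
    unfolding V_def units_of_carrier by (rule m.res_units_eq)
  have cm: "x mod ?m \<in> carrier V" if "coprime x ?m" for x
    unfolding V_def units_of_carrier using m.mod_in_res_units[OF m1 that] .
  have cn: "x mod ?n \<in> carrier W" if "coprime x ?n" for x
    unfolding W_def units_of_carrier using n.mod_in_res_units[OF n1 that] .
  have img: "x mod ?m \<in> carrier V" if "x \<in> carrier W" for x
    using that cm by (simp add: units_n)
  show "(\<lambda>x. x mod ?m) \<in> hom W V"
  proof (rule homI)
    show "x mod ?m \<in> carrier V" if "x \<in> carrier W" for x using img[OF that] .
    show "(x \<otimes>\<^bsub>W\<^esub> y) mod ?m = (x mod ?m) \<otimes>\<^bsub>V\<^esub> (y mod ?m)" for x y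
      using m_n by (simp only: W_def V_def units_of_mult n.res_mult_eq m.res_mult_eq mod_mod_cancel mod_mult_eq)
  qed
  show "(\<lambda>x. x mod ?m) ` carrier W = carrier V"
  proof
    show "(\<lambda>x. x mod ?m) ` carrier W \<subseteq> carrier V" using img by blast
    show "carrier V \<subseteq> (\<lambda>x. x mod ?m) ` carrier W"
    proof
      fix y assume y: "y \<in> carrier V"
      have "coprime (int (p ^ k)) ?m" using pq primes_coprime[of p q] by simp
      then obtain x where x: "[x = 1] (mod int (p ^ k))" "[x = y] (mod ?m)"
        using binary_chinese_remainder_int by blast
      have "coprime x (int (p ^ k))" using x(1) cong_imp_coprime[of 1 x "int (p ^ k)"] cong_sym by auto
      moreover have "coprime x ?m" using x(2) y cong_imp_coprime[of y x ?m] cong_sym by (auto simp: units_m)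
      ultimately have "coprime x ?n" by simp
      then have "x mod ?n \<in> carrier W" by (rule cn)
      moreover have "(x mod ?n) mod ?m = y"
        using m_n x(2) y by (simp add: mod_mod_cancel cong_def units_m)
      ultimately show "y \<in> (\<lambda>x. x mod ?m) ` carrier W" by (metis imageI)
    qed
  qed
qed

text \<open>The given elements are units or, if divisible by \<open>p\<close>, marked. Either the
  units have a product-one subsequence, or \<open>marked_extract\<close> gives a product that is 1
  modulo \<open>q ^ l\<close> and contains at least \<open>k\<close> multiples of \<open>p\<close>,
  so that it is 0 modulo \<open>p ^ k\<close>.\<close>

lemma idempotent_subproduct:
  fixes p q k l :: nat and f :: "'i \<Rightarrow> int"
  assumes pq: "prime p" "prime q" "p \<noteq> q" "k > 0" "l > 0"
  defines "R \<equiv> residue_ring (int (p ^ k * q ^ l))"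
  assumes I: "finite I" "f \<in> I \<rightarrow> carrier R" "\<And>i. i \<in> I \<Longrightarrow> \<not> int q dvd f i"
    and card: "davenport (units_of R) + k \<le> card I + 1"
  shows "\<exists>J\<subseteq>I. J \<noteq> {} \<and> [(\<Prod>i\<in>J. f i) * (\<Prod>i\<in>J. f i) = (\<Prod>i\<in>J. f i)] (mod int (p ^ k * q ^ l))"
proof -
  let ?n = "int (p ^ k * q ^ l)" and ?m = "int (q ^ l)"
  define W where "W = units_of R"
  define V where "V = units_of (residue_ring ?m)"
  define h where "h = (\<lambda>x. x mod ?m)"
  have m1: "?m > 1" and n1: "?n > 1" by (rule moduli_gt_one[OF pq(1,2,4,5)])+
  interpret n: residues ?n R unfolding R_def by (unfold_locales, rule n1) simp
  interpret m: residues ?m "residue_ring ?m" by (unfold_locales, rule m1) simp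
  have W: "comm_group W" unfolding W_def by (rule n.units_comm_group)
  have V: "comm_group V" unfolding V_def by (rule m.units_comm_group)
  interpret W: comm_group W by fact
  interpret V: comm_group V by fact
  have W_fin: "finite (carrier W)" unfolding W_def units_of_carrier by (rule n.finite_Units)
  have V_fin: "finite (carrier V)" unfolding V_def units_of_carrier by (rule m.finite_Units)
  have h: "h \<in> hom W V" "h ` carrier W = carrier V"
    using units_reduction[OF pq] by (simp_all only: h_def W_def V_def R_def)
  have bound: "length ws < davenport W" if "set ws \<subseteq> carrier W" "product_free W ws" for ws
    using W.length_product_free[OF W_fin that] .
  define U where "U = {i \<in> I. \<not> int p dvd f i}"
  define X where "X = {i \<in> I. int p dvd f i}"
  have fin: "finite U" "finite X" using I(1) by (simp_all add: U_def X_def)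
  have cardI: "card I = card U + card X"
  proof -
    have "I = U \<union> X" "U \<inter> X = {}" by (auto simp: U_def X_def)
    then show ?thesis using fin card_Un_disjoint by metis
  qed
  have fU: "f \<in> U \<rightarrow> Units R"
  proof
    fix i assume i: "i \<in> U"
    have "f i \<in> carrier R" using i I(2) by (auto simp: U_def)
    then have r: "0 \<le> f i" "f i < ?n" by (auto simp: n.res_carrier_eq)
    have "coprime (f i) ?n"
      unfolding coprime_prime_powers_iff[OF pq(1,2,4,5)] using i I(3) by (auto simp: U_def)
    moreover have "f i \<noteq> 0" using i by (auto simp: U_def)
    ultimately show "f i \<in> Units R" using r by (simp add: n.res_units_eq)
  qed
  then have fW: "f \<in> U \<rightarrow> carrier W" by (simp add: W_def units_of_carrier)
  have prod_U: "finprod W f J = (\<Prod>i\<in>J. f i) mod ?n" if "J \<subseteq> U" for J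
    unfolding W_def using fU that finite_subset[OF that fin(1)] by (intro n.finprod_residue_units) auto
  show ?thesis
  proof (cases "\<exists>J\<subseteq>U. J \<noteq> {} \<and> finprod W f J = \<one>\<^bsub>W\<^esub>")
    case True
    then obtain J where J: "J \<subseteq> U" "J \<noteq> {}" "finprod W f J = \<one>\<^bsub>W\<^esub>" by blast
    then have "(\<Prod>i\<in>J. f i) mod ?n = 1" using prod_U by (simp add: W_def units_of_one n.res_one_eq)
    then have "[(\<Prod>i\<in>J. f i) = 1] (mod ?n)" using n1 by (simp add: cong_def)
    then have "[(\<Prod>i\<in>J. f i) * (\<Prod>i\<in>J. f i) = 1 * (\<Prod>i\<in>J. f i)] (mod ?n)" by (rule cong_scalar_right)
    moreover have "J \<subseteq> I" using J(1) by (auto simp: U_def)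
    ultimately show ?thesis using J(2) by auto
  next
    case False
    then have free: "finprod W f J \<noteq> \<one>\<^bsub>W\<^esub>" if "J \<subseteq> U" "J \<noteq> {}" for J using that by blast
    \<comment> \<open>Product-free units are fewer than the Davenport constant, so at least
      \<open>k\<close> elements are marked.\<close>
    have "card U < davenport W"
    proof -
      obtain us where us: "distinct us" "set us = U" using finite_distinct_list[OF fin(1)] by blast
      have fus: "f \<in> set us \<rightarrow> carrier W" using fW us(2) by simp
      have "product_free W (map f us)"
        unfolding W.product_free_map[OF us(1) fus] us(2) using free by blast
      moreover have "set (map f us) \<subseteq> carrier W" using fus by auto
      ultimately have "length (map f us) < davenport W" by (intro bound)
      then show ?thesis using distinct_card[OF us(1)] us(2) by simp
    qed
    then have kX: "k \<le> card X" using card cardI by (simp add: W_def)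
    have tame: "tame V" unfolding V_def by (rule tame_units_prime_power[OF pq(2,5)])
    have qX: "coprime (f i) ?m" if "i \<in> I" for i
      using I(3)[OF that] prime_imp_coprime[of "int q" "f i"] pq(2) by (simp add: coprime_commute)
    have hX: "(\<lambda>i. h (f i)) \<in> X \<rightarrow> Units (residue_ring ?m)"
      using m.mod_in_res_units[OF m1] qX by (auto simp: X_def h_def)
    then have gX: "(\<lambda>i. h (f i)) \<in> X \<rightarrow> carrier V" by (simp add: V_def units_of_carrier)
    have card': "davenport W + k \<le> card U + card X + 1" using card cardI by (simp add: W_def)
    obtain J Z where JZ: "J \<subseteq> U" "Z \<subseteq> X" "k \<le> card Z"
      "h (finprod W f J) \<otimes>\<^bsub>V\<^esub> finprod V (\<lambda>i. h (f i)) Z = \<one>\<^bsub>V\<^esub>"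
      using marked_extract[OF W V V_fin tame h fin(1) fW fin(2) gX free bound card' kX] by blast
    have fJZ: "finite J" "finite Z" "J \<inter> Z = {}" "J \<union> Z \<subseteq> I"
      using JZ(1,2) fin finite_subset by (auto simp: U_def X_def)
    define P where "P = (\<Prod>i\<in>J \<union> Z. f i)"
    have P: "P = (\<Prod>i\<in>J. f i) * (\<Prod>i\<in>Z. f i)" unfolding P_def using fJZ by (intro prod.union_disjoint)
    have "finprod V (\<lambda>i. h (f i)) Z = (\<Prod>i\<in>Z. h (f i)) mod ?m"
      unfolding V_def using hX JZ(2) fJZ(2) by (intro m.finprod_residue_units) auto
    also have "\<dots> = (\<Prod>i\<in>Z. f i) mod ?m" by (simp add: h_def mod_prod_eq)
    finally have Z: "finprod V (\<lambda>i. h (f i)) Z = (\<Prod>i\<in>Z. f i) mod ?m" .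
    have J: "h (finprod W f J) = (\<Prod>i\<in>J. f i) mod ?m"
      unfolding prod_U[OF JZ(1)] h_def by (rule mod_mod_cancel) simp
    have "h (finprod W f J) \<otimes>\<^bsub>V\<^esub> finprod V (\<lambda>i. h (f i)) Z = P mod ?m"
      unfolding Z J P unfolding V_def units_of_mult m.res_mult_eq by (rule mod_mult_eq)
    moreover have "\<one>\<^bsub>V\<^esub> = 1" unfolding V_def units_of_one by (rule m.res_one_eq)
    ultimately have "P mod ?m = 1" using JZ(4) by simp
    then have P1: "[P = 1] (mod ?m)" using m1 by (simp add: cong_def)
    have "int p ^ k dvd (\<Prod>i\<in>Z. f i)"
      using fJZ(2) JZ(2,3) by (intro power_dvd_prod_if_card) (auto simp: X_def)
    then have P0: "int p ^ k dvd P" unfolding P by (rule dvd_mult)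
    have "coprime (int p ^ k) ?m" using pq primes_coprime[of p q] by simp
    then have "[P * P = P] (mod int p ^ k * ?m)" using P0 P1 by (rule idempotent_modI)
    then have "[P * P = P] (mod ?n)" by simp
    moreover have "J \<union> Z \<noteq> {}" using JZ(3) pq(4) by auto
    ultimately show ?thesis using fJZ(4) unfolding P_def by blast
  qed
qed

section \<open>The lower bound\<close>

text \<open>The only idempotents modulo a prime power are 0 and 1, and a number divisible by
  \<open>p\<close> exactly \<open>a\<close> times with \<open>0 < a < k\<close> is neither.\<close>

lemma no_partial_prime_power_idempotent:
  fixes P :: int and p a k :: nat
  assumes "prime p" "a < k" "[P = u * int p ^ a] (mod int p ^ k)" "\<not> int p dvd u" "int p ^ k dvd P * P - P"
  shows "a = 0"
proof (rule ccontr)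
  assume "a \<noteq> 0"
  have p: "prime (int p)" using assms(1) by simp
  have k: "k = a + (k - a)" "k - a > 0" using assms(2) by auto
  have "int p dvd int p ^ k" using assms(2) by simp
  moreover have "int p dvd u * int p ^ a" using \<open>a \<noteq> 0\<close> by simp
  ultimately have "int p dvd P" using assms(3) by (meson cong_dvd_iff cong_dvd_modulus)
  have "\<not> int p dvd P - 1"
  proof
    assume "int p dvd P - 1"
    with \<open>int p dvd P\<close> have "int p dvd P - (P - 1)" by (rule dvd_diff)
    then show False using p by simp
  qed
  then have "coprime (int p) (P - 1)" by (rule prime_imp_coprime[OF p])
  then have "coprime (int p ^ k) (P - 1)" by simp
  moreover have "int p ^ k dvd P * (P - 1)" using assms(5) by (simp add: algebra_simps)
  ultimately have "int p ^ k dvd P" by (simp add: coprime_dvd_mult_left_iff)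
  then have "int p ^ k dvd u * int p ^ a" using assms(3) by (meson cong_dvd_iff dvd_refl)
  then have "int p ^ (k - a) * int p ^ a dvd u * int p ^ a" using k(1) by (metis add.commute power_add)
  then have "int p ^ (k - a) dvd u" using assms(1) prime_gt_0_nat by simp
  then show False using assms(4) k(2) by (meson dvd_power dvd_trans)
qed

text \<open>The extremal sequence consists of a longest product-free sequence of units,
  \<open>k - 1\<close> copies of a number that is \<open>p\<close> modulo \<open>p ^ k\<close> and 1
  modulo \<open>q ^ l\<close>, and \<open>l - 1\<close> copies of its mirror image. An idempotent
  product can use only the units.\<close>

lemma erdos_burgess_lower:
  fixes p q k l :: nat
  assumes pq: "prime p" "prime q" "p \<noteq> q" "k > 0" "l > 0"
  defines "R \<equiv> residue_ring (int (p ^ k * q ^ l))"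
  shows "\<not> erdos_burgess_property R (davenport (units_of R) - 1 + (k - 1) + (l - 1))"
proof
  let ?n = "int (p ^ k * q ^ l)"
  have n1: "?n > 1" by (rule moduli_gt_one(2)[OF pq(1,2,4,5)])
  interpret n: residues ?n R unfolding R_def by (unfold_locales, rule n1) simp
  define W where "W = units_of R"
  have W: "comm_group W" unfolding W_def by (rule n.units_comm_group)
  define d where "d = davenport W - 1"
  obtain w where w: "w \<in> {..<d} \<rightarrow> carrier W"
    and free: "\<And>I. I \<subseteq> {..<d} \<Longrightarrow> I \<noteq> {} \<Longrightarrow> finprod W w I \<noteq> \<one>\<^bsub>W\<^esub>"
    using comm_group.davenport_witness[OF W] unfolding d_def by blast
  have wU: "w i \<in> Units R" if "i < d" for i
    using w that by (auto simp: W_def units_of_carrier)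
  have w_unit: "0 < w i \<and> w i < ?n \<and> coprime (w i) ?n" if "i < d" for i
    using wU[OF that] unfolding n.res_units_eq by blast
  have w_range: "0 \<le> w i" "w i < ?n" "\<not> int p dvd w i" "\<not> int q dvd w i" if "i < d" for i
    using w_unit[OF that] unfolding coprime_prime_powers_iff[OF pq(1,2,4,5)] by linarith+
  have cop: "coprime (int (p ^ k)) (int (q ^ l))" using pq primes_coprime[of p q] by simp
  obtain x where x: "[x = int p] (mod int (p ^ k))" "[x = 1] (mod int (q ^ l))"
    using binary_chinese_remainder_int[OF cop] by blast
  obtain y where y: "[y = 1] (mod int (p ^ k))" "[y = int q] (mod int (q ^ l))"
    using binary_chinese_remainder_int[OF cop] by blast
  define F where "F = (\<lambda>i. if i < d then w i else if i < d + (k - 1) then x mod ?n else y mod ?n)"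
  let ?t = "d + (k - 1) + (l - 1)"
  assume "erdos_burgess_property R (davenport (units_of R) - 1 + (k - 1) + (l - 1))"
  then have property: "erdos_burgess_property R ?t" by (simp add: d_def W_def)
  have FR: "F \<in> {..<?t} \<rightarrow> carrier R"
  proof
    fix i
    show "F i \<in> carrier R"
      using w_range(1,2)[of i] n1 by (cases "i < d") (simp_all add: F_def n.res_carrier_eq)
  qed
  obtain I where I: "I \<subseteq> {..<?t}" "I \<noteq> {}" "finprod R F I \<otimes>\<^bsub>R\<^esub> finprod R F I = finprod R F I"
    using bspec[OF property[unfolded erdos_burgess_property_def] FR] by (elim exE conjE)
  have finI: "finite I" by (rule finite_subset[OF I(1)]) simp
  define I0 where "I0 = I \<inter> {..<d}"
  define I1 where "I1 = I \<inter> {d..<d + (k - 1)}"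
  define I2 where "I2 = I \<inter> {d + (k - 1)..<?t}"
  have split: "{..<?t} = {..<d} \<union> ({d..<d + (k - 1)} \<union> {d + (k - 1)..<?t})"
    by (simp add: ivl_disj_un_one ivl_disj_un_two)
  have parts: "I = I0 \<union> (I1 \<union> I2)" "finite I0" "finite I1" "finite I2"
    "I0 \<inter> (I1 \<union> I2) = {}" "I1 \<inter> I2 = {}"
  proof -
    show "I = I0 \<union> (I1 \<union> I2)"
      using I(1) split unfolding I0_def I1_def I2_def by blast
    show "finite I0" "finite I1" "finite I2" using finI by (simp_all add: I0_def I1_def I2_def)
    show "I0 \<inter> (I1 \<union> I2) = {}" "I1 \<inter> I2 = {}"
      unfolding I0_def I1_def I2_def by (rule equals0I, auto)+
  qed
  define P where "P = (\<Prod>i\<in>I. F i)"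
  define u where "u = (\<Prod>i\<in>I0. w i)"
  have "(\<Prod>i\<in>I0. F i) = u" unfolding u_def by (rule prod.cong) (auto simp: I0_def F_def)
  moreover have "(\<Prod>i\<in>I1. F i) = (x mod ?n) ^ card I1"
  proof -
    have "(\<Prod>i\<in>I1. F i) = (\<Prod>i\<in>I1. x mod ?n)" by (rule prod.cong) (auto simp: I1_def F_def)
    then show ?thesis by simp
  qed
  moreover have "(\<Prod>i\<in>I2. F i) = (y mod ?n) ^ card I2"
  proof -
    have "(\<Prod>i\<in>I2. F i) = (\<Prod>i\<in>I2. y mod ?n)" by (rule prod.cong) (auto simp: I2_def F_def)
    then show ?thesis by simp
  qed
  moreover have "P = (\<Prod>i\<in>I0. F i) * ((\<Prod>i\<in>I1. F i) * (\<Prod>i\<in>I2. F i))"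
    unfolding P_def parts(1) using parts(2-6) by (simp add: prod.union_disjoint)
  ultimately have P: "P = u * ((x mod ?n) ^ card I1 * (y mod ?n) ^ card I2)" by simp
  have red: "[x mod ?n = x] (mod r)" "[y mod ?n = y] (mod r)" if "r dvd ?n" for r
    using that by (simp_all add: cong_def mod_mod_cancel)
  have Pp: "[P = u * int p ^ card I1] (mod int p ^ k)"
  proof -
    have dv: "int p ^ k dvd ?n" by simp
    have "[x mod ?n = int p] (mod int p ^ k)" "[y mod ?n = 1] (mod int p ^ k)"
      using cong_trans[OF red(1)[OF dv]] cong_trans[OF red(2)[OF dv]] x(1) y(1) by simp_all
    then have "[P = u * (int p ^ card I1 * 1 ^ card I2)] (mod int p ^ k)"
      unfolding P by (intro cong_mult cong_pow cong_refl)
    then show ?thesis by simp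
  qed
  have Pq: "[P = u * int q ^ card I2] (mod int q ^ l)"
  proof -
    have dv: "int q ^ l dvd ?n" by simp
    have "[x mod ?n = 1] (mod int q ^ l)" "[y mod ?n = int q] (mod int q ^ l)"
      using cong_trans[OF red(1)[OF dv]] cong_trans[OF red(2)[OF dv]] x(2) y(2) by simp_all
    then have "[P = u * (1 ^ card I1 * int q ^ card I2)] (mod int q ^ l)"
      unfolding P by (intro cong_mult cong_pow cong_refl)
    then show ?thesis by simp
  qed
  have FI: "F \<in> I \<rightarrow> carrier R" using FR I(1) by blast
  have "finprod R F I = P mod ?n" unfolding P_def by (rule n.finprod_residues[OF FI finI])
  then have "[P * P = P] (mod ?n)"
    using I(3) by (simp add: n.res_mult_eq cong_def mod_simps)
  then have dvd: "?n dvd P * P - P" by (simp add: cong_iff_dvd_diff)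
  have up: "\<not> int p dvd u" "\<not> int q dvd u"
    unfolding u_def using pq(1,2) parts(2) w_range(3,4)
    by (auto simp: prime_dvd_prod_iff I0_def)
  \<comment> \<open>There are too few copies for \<open>P\<close> to vanish modulo
    \<open>p ^ k\<close> or \<open>q ^ l\<close>.\<close>
  have "card I1 \<le> card {d..<d + (k - 1)}" "card I2 \<le> card {d + (k - 1)..<?t}"
    by (intro card_mono; simp add: I1_def I2_def)+
  then have cI: "card I1 < k" "card I2 < l" using pq(4,5) by simp_all
  have "int p ^ k dvd P * P - P" "int q ^ l dvd P * P - P"
    using dvd by (auto intro: dvd_trans)
  then have "card I1 = 0" "card I2 = 0"
    using no_partial_prime_power_idempotent[OF pq(1) cI(1) Pp up(1)]
      no_partial_prime_power_idempotent[OF pq(2) cI(2) Pq up(2)] by blast+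
  then have I_I0: "I = I0" and P_u: "P = u" using parts(1,3,4) P by simp_all
  \<comment> \<open>An idempotent unit is one, against the choice of \<open>w\<close>.\<close>
  have "coprime u ?n" unfolding coprime_prime_powers_iff[OF pq(1,2,4,5)] using up by blast
  moreover have "?n dvd u * (u - 1)" using dvd by (simp add: P_u algebra_simps)
  ultimately have "?n dvd u - 1" by (simp add: coprime_dvd_mult_right_iff coprime_commute)
  then have "u mod ?n = 1" using n1 by (simp add: mod_eq_dvd_iff[symmetric])
  moreover have "finprod W w I0 = u mod ?n"
    unfolding W_def u_def using wU parts(2) by (intro n.finprod_residue_units) (auto simp: I0_def)
  ultimately have "finprod W w I0 = \<one>\<^bsub>W\<^esub>" by (simp add: W_def units_of_one n.res_one_eq)
  moreover have "I0 \<subseteq> {..<d}" unfolding I0_def by blast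
  moreover have "I0 \<noteq> {}" using I(2) I_I0 by blast
  ultimately show False using free by blast
qed

section \<open>The upper bound\<close>

text \<open>If at most \<open>l - 1\<close> elements are multiples of \<open>q\<close>, or at most
  \<open>k - 1\<close> are multiples of \<open>p\<close>, dropping them leaves enough for
  \<open>idempotent_subproduct\<close>. Otherwise the whole product is 0.\<close>

lemma erdos_burgess_upper:
  fixes p q k l :: nat
  assumes pq: "prime p" "prime q" "p \<noteq> q" "k > 0" "l > 0"
  defines "R \<equiv> residue_ring (int (p ^ k * q ^ l))"
  shows "erdos_burgess_property R (davenport (units_of R) + (k - 1) + (l - 1))"
  unfolding erdos_burgess_property_def
proof
  let ?n = "int (p ^ k * q ^ l)"
  have n1: "?n > 1" by (rule moduli_gt_one(2)[OF pq(1,2,4,5)])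
  interpret n: residues ?n R unfolding R_def by (unfold_locales, rule n1) simp
  define T where "T = davenport (units_of R) + (k - 1) + (l - 1)"
  fix f assume f: "f \<in> {..<davenport (units_of R) + (k - 1) + (l - 1)} \<rightarrow> carrier R"
  then have fT: "f \<in> {..<T} \<rightarrow> carrier R" by (simp add: T_def)
  define A where "A = {i \<in> {..<T}. int p dvd f i}"
  define B where "B = {i \<in> {..<T}. int q dvd f i}"
  have AB: "finite A" "finite B" "A \<subseteq> {..<T}" "B \<subseteq> {..<T}" by (auto simp: A_def B_def)
  have cards: "card ({..<T} - A) = T - card A" "card ({..<T} - B) = T - card B"
    using AB by (simp_all add: card_Diff_subset)
  have "\<exists>J\<subseteq>{..<T}. J \<noteq> {} \<and> [(\<Prod>i\<in>J. f i) * (\<Prod>i\<in>J. f i) = (\<Prod>i\<in>J. f i)] (mod ?n)"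
  proof -
    consider "card B < l" | "card A < k" | "k \<le> card A" "l \<le> card B" by linarith
    then show ?thesis
    proof cases
      case 1
      have "\<exists>J\<subseteq>{..<T} - B. J \<noteq> {} \<and> [(\<Prod>i\<in>J. f i) * (\<Prod>i\<in>J. f i) = (\<Prod>i\<in>J. f i)] (mod ?n)"
      proof (rule idempotent_subproduct[OF pq])
        show "f \<in> {..<T} - B \<rightarrow> carrier (residue_ring ?n)" using fT by (auto simp: R_def)
        show "davenport (units_of (residue_ring ?n)) + k \<le> card ({..<T} - B) + 1"
          using 1 pq(4) cards(2) by (simp add: T_def R_def)
      qed (auto simp: B_def)
      then show ?thesis by blast
    next
      case 2
      \<comment> \<open>The two primes exchange roles, so the modulus has to be rewritten.\<close>
      have comm: "p ^ k * q ^ l = q ^ l * p ^ k" by simp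
      have "\<exists>J\<subseteq>{..<T} - A. J \<noteq> {} \<and> [(\<Prod>i\<in>J. f i) * (\<Prod>i\<in>J. f i) = (\<Prod>i\<in>J. f i)] (mod int (q ^ l * p ^ k))"
      proof (rule idempotent_subproduct[OF pq(2,1) pq(3)[symmetric] pq(5,4)])
        show "f \<in> {..<T} - A \<rightarrow> carrier (residue_ring (int (q ^ l * p ^ k)))"
          using fT unfolding R_def comm by auto
        show "davenport (units_of (residue_ring (int (q ^ l * p ^ k)))) + l \<le> card ({..<T} - A) + 1"
          using 2 pq(5) cards(1) unfolding T_def R_def comm by simp
      qed (auto simp: A_def)
      then show ?thesis unfolding comm by blast
    next
      case 3
      define P where "P = (\<Prod>i\<in>{..<T}. f i)"
      have "int p ^ k dvd (\<Prod>i\<in>A. f i)" using AB(1) 3(1) by (intro power_dvd_prod_if_card) (auto simp: A_def)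
      also have "\<dots> dvd P" unfolding P_def using AB(3) by (intro prod_dvd_prod_subset) auto
      finally have p: "int p ^ k dvd P" .
      have "int q ^ l dvd (\<Prod>i\<in>B. f i)" using AB(2) 3(2) by (intro power_dvd_prod_if_card) (auto simp: B_def)
      also have "\<dots> dvd P" unfolding P_def using AB(4) by (intro prod_dvd_prod_subset) auto
      finally have q: "int q ^ l dvd P" .
      have "coprime (int p ^ k) (int q ^ l)" using pq primes_coprime[of p q] by simp
      with p q have "int p ^ k * int q ^ l dvd P" by (rule divides_mult)
      then have "?n dvd P" by simp
      then have "[P * P = P] (mod ?n)" by (simp add: cong_iff_dvd_diff)
      moreover have "{..<T} \<noteq> {}" using 3(1) pq(4) AB(3) by auto
      ultimately show ?thesis unfolding P_def by blast
    qed
  qed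
  then obtain J where J: "J \<subseteq> {..<T}" "J \<noteq> {}" "[(\<Prod>i\<in>J. f i) * (\<Prod>i\<in>J. f i) = (\<Prod>i\<in>J. f i)] (mod ?n)"
    by blast
  have "finprod R f J = (\<Prod>i\<in>J. f i) mod ?n"
    using fT J(1) finite_subset[OF J(1)] by (intro n.finprod_residues) auto
  then have "finprod R f J \<otimes>\<^bsub>R\<^esub> finprod R f J = finprod R f J"
    using J(3) by (simp add: n.res_mult_eq cong_def mod_simps)
  then show "\<exists>I\<subseteq>{..<davenport (units_of R) + (k - 1) + (l - 1)}. I \<noteq> {} \<and>
      finprod R f I \<otimes>\<^bsub>R\<^esub> finprod R f I = finprod R f I"
    using J(1,2) unfolding T_def by blast
qed

theorem theorem1p7:
  fixes p q k l n :: nat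
  assumes "prime p" and "prime q" and "p \<noteq> q"
    and "k > 0" and "l > 0"
    and "n = p ^ k * q ^ l"
  shows "erdos_burgess (residue_ring (int n)) =
    davenport (units_of (residue_ring (int n))) + (k - 1) + (l - 1)"
proof -
  have n1: "int n > 1" using moduli_gt_one(2)[OF assms(1,2,4,5)] assms(6) by simp
  interpret residues "int n" "residue_ring (int n)" by (unfold_locales, rule n1) simp
  define d where "d = davenport (units_of (residue_ring (int n)))"
  have "finite (carrier (units_of (residue_ring (int n))))" unfolding units_of_carrier by (rule finite_Units)
  then have "d > 0" unfolding d_def using comm_group.davenport_attained[OF units_comm_group] by blast
  \<comment> \<open>Positivity of \<open>d\<close> makes the truncated \<open>d - 1\<close>
    harmless: the sequence of the lower bound is shorter by one than the claimed value.\<close>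
  then have "Suc (d - 1 + (k - 1) + (l - 1)) = d + (k - 1) + (l - 1)" by simp
  moreover have "\<not> erdos_burgess_property (residue_ring (int n)) (d - 1 + (k - 1) + (l - 1))"
    using erdos_burgess_lower[OF assms(1-5)] unfolding d_def assms(6) .
  moreover have "erdos_burgess_property (residue_ring (int n)) (d + (k - 1) + (l - 1))"
    using erdos_burgess_upper[OF assms(1-5)] unfolding d_def assms(6) .
  ultimately show ?thesis
    using erdos_burgess_eqI[of "residue_ring (int n)" "d - 1 + (k - 1) + (l - 1)"] unfolding d_def by simp
qed

end
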